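(* Let $k\ge 1$ and let $H$ be the subgroup of $\mathrm{Aut}(X^* )$ generated by the automorphisms defined by the wreath recursions $r_0=\sigma(\mathrm{id},\mathrm{id})$, $r_i=(r_{i-1},\mathrm{id})$ for $1\le i\le k$, $b_0=(r_k,b_1)$, $b_1=(r_k,b_2)$, $b_2=(\mathrm{id},b_0)$. Then the topological closure $\overline{H}$ of $H$ in $\mathrm{Aut}(X^* )$ is a topologically finitely generated, finitely constrained group defined by patterns of size $d=k+4$, and $\mathrm{Hdim}(\overline{H})=1-\frac{2}{2^{d-1}}$.
   Context: Let $X=\{0,1\}$ and let $X^*$ be the rooted binary tree of finite words. $G=\mathrm{Aut}(X^* )$. For $g\in G$ and $w\in X^*$ the section $g_w$ is defined by $g(wv)=g(w)g_w(v)$. Wreath recursion: $g=\sigma^{\varepsilon}(g_0,g_1)$ means $g(xw)=\sigma^\varepsilon(x)g_x(w)$ for $x\in X$, where $\sigma$ swaps $0$ and $1$ and $\sigma^0$ is the identity. $G(d)$ is the automorphism group of the finite tree of words of length $\le d$, $\pi_k$ is restriction to words of length $\le k$, $H(k)=\pi_k(H)$. A subgroup $P\le G(d)$ is an essential pattern group if for every $p\in P$ and $i\in\{0,1\}$ there is $q\in P$ with $\pi_{d-1}(q)=p_i$; $G_P=\{g\in G:\pi_d(g_w)\in P\ \forall w\}$. A subgroup is finitely constrained if it equals some $G_P$, and defined by patterns of size $d$ if $d$ is the minimal such size. A closed subgroup is topologically finitely generated if it has a finitely generated dense subgroup (profinite topology). $\mathrm{Hdim}(K)=\liminf_n\log_2|K(n)|/\log_2|G(n)|$.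 *)

theory Defs
  imports "HOL-Library.Liminf_Limsup" "HOL-Library.Extended_Real" Complex_Main
begin

text \<open>Letters: X = {0,1} is encoded as bool (0 = False, 1 = True).
  Vertices of the tree X^* are words :: bool list.
  Automorphisms of X^* are bijections of words preserving length and prefixes.\<close>

type_synonym word = "bool list"
type_synonym tmap = "word \<Rightarrow> word"

definition tree_aut :: "tmap \<Rightarrow> bool" where
  "tree_aut g \<longleftrightarrow> bij g \<and> (\<forall>w. length (g w) = length w)
     \<and> (\<forall>w v. take (length w) (g (w @ v)) = g w)"

definition Aut :: "tmap set" where
  "Aut = {g. tree_aut g}"

definition sect :: "tmap \<Rightarrow> word \<Rightarrow> tmap" where
  "sect g w = (\<lambda>v. drop (length w) (g (w @ v)))"

text \<open>Restriction pi_d to the finite tree of words of length <= d;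
  elements of G(d) are represented as maps acting trivially on longer words.\<close>
definition restr :: "nat \<Rightarrow> tmap \<Rightarrow> tmap" where
  "restr d g = (\<lambda>w. if length w \<le> d then g w else w)"

definition Gfin :: "nat \<Rightarrow> tmap set" where
  "Gfin d = restr d ` Aut"

definition is_subgroup_of :: "tmap set \<Rightarrow> tmap set \<Rightarrow> bool" where
  "is_subgroup_of P G \<longleftrightarrow> P \<subseteq> G \<and> id \<in> P \<and> (\<forall>p\<in>P. \<forall>q\<in>P. p \<circ> q \<in> P)
      \<and> (\<forall>p\<in>P. inv p \<in> P)"

definition essential_pattern_group :: "nat \<Rightarrow> tmap set \<Rightarrow> bool" where
  "essential_pattern_group d P \<longleftrightarrow> is_subgroup_of P (Gfin d) \<and>
     (\<forall>p\<in>P. \<forall>i::bool. \<exists>q\<in>P. restr (d - 1) q = sect p [i])"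

definition G_P :: "nat \<Rightarrow> tmap set \<Rightarrow> tmap set" where
  "G_P d P = {g \<in> Aut. \<forall>w. restr d (sect g w) \<in> P}"

definition constrained_by_size :: "tmap set \<Rightarrow> nat \<Rightarrow> bool" where
  "constrained_by_size K d \<longleftrightarrow> (\<exists>P. essential_pattern_group d P \<and> K = G_P d P)"

definition finitely_constrained :: "tmap set \<Rightarrow> bool" where
  "finitely_constrained K \<longleftrightarrow> (\<exists>d. constrained_by_size K d)"

definition defined_by_patterns_of_size :: "tmap set \<Rightarrow> nat \<Rightarrow> bool" where
  "defined_by_patterns_of_size K d \<longleftrightarrow>
     constrained_by_size K d \<and> (\<forall>d'. constrained_by_size K d' \<longrightarrow> d \<le> d')"

inductive_set gen_subgroup :: "tmap set \<Rightarrow> tmap set" for S where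
  gen_id: "id \<in> gen_subgroup S"
| gen_el: "s \<in> S \<Longrightarrow> s \<in> gen_subgroup S"
| gen_comp: "g \<in> gen_subgroup S \<Longrightarrow> h \<in> gen_subgroup S \<Longrightarrow> g \<circ> h \<in> gen_subgroup S"
| gen_inv: "g \<in> gen_subgroup S \<Longrightarrow> inv g \<in> gen_subgroup S"

text \<open>Topological closure in Aut(X^*) w.r.t. the profinite topology:
  g lies in the closure of H iff every level restriction of g is realised by some h in H.\<close>
definition tclosure :: "tmap set \<Rightarrow> tmap set" where
  "tclosure H = {g \<in> Aut. \<forall>n. \<exists>h\<in>H. restr n g = restr n h}"

definition top_fin_gen :: "tmap set \<Rightarrow> bool" where
  "top_fin_gen K \<longleftrightarrow> (\<exists>S. finite S \<and> S \<subseteq> K \<and> tclosure (gen_subgroup S) = K)"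

definition Hdim :: "tmap set \<Rightarrow> ereal" where
  "Hdim K = liminf (\<lambda>n. ereal (log 2 (real (card (restr n ` K)))
                               / log 2 (real (card (restr n ` Aut)))))"

text \<open>The automaton defining the generators.  States: R i (r_i), B j (b_j), E (identity).\<close>
datatype st = R nat | B nat | E

fun flip :: "st \<Rightarrow> bool" where
  "flip (R 0) = True"
| "flip _ = False"

fun child :: "nat \<Rightarrow> st \<Rightarrow> bool \<Rightarrow> st" where
  "child k (R 0) x = E"
| "child k (R (Suc i)) x = (if x then E else R i)"
| "child k (B j) x = (if j = 0 then (if x then B 1 else R k)
                      else if j = 1 then (if x then B 2 else R k)
                      else (if x then B 0 else E))"
| "child k E x = E"

fun act :: "nat \<Rightarrow> st \<Rightarrow> tmap" where
  "act k s [] = []"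
| "act k s (x # w) = (if flip s then \<not> x else x) # act k (child k s x) w"

definition gens :: "nat \<Rightarrow> tmap set" where
  "gens k = {act k (R i) | i. i \<le> k} \<union> {act k (B j) | j. j < 3}"

definition Hgrp :: "nat \<Rightarrow> tmap set" where
  "Hgrp k = gen_subgroup (gens k)"

end

theory Submission
  imports Defs
begin

text \<open>
  Let \<open>a\<^sub>j(g)\<close> be the parity of the number of vertices of level \<open>j\<close> at which \<open>g\<close> acts as a flip; every \<open>a\<^sub>j\<close> is
  a homomorphism to \<open>\<int>/2\<close>. The closure of \<open>H\<close> is the group \<open>K\<close> of all \<open>g\<close> such that every section
  \<open>h = (h\<^sub>0, h\<^sub>1)\<close> of \<open>g\<close>, up to the top flip, satisfies \<open>a\<^sub>k(h\<^sub>x) = a\<^sub>k\<^sub>+\<^sub>1(h\<^sub>1\<^sub>-\<^sub>x) + a\<^sub>k\<^sub>+\<^sub>2(h\<^sub>1\<^sub>-\<^sub>x)\<close> for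
  \<open>x = 0, 1\<close>. These two conditions only see \<open>h\<close> up to level \<open>k + 3\<close>, so \<open>K\<close> is given by patterns of size \<open>k + 4\<close>.

  Density of \<open>H\<close> in \<open>K\<close> is proved level by level. Up to level \<open>k + 2\<close> there is no constraint, and conjugates of
  \<open>r\<^sub>i\<close>, \<open>b\<^sub>0\<close> and \<open>b\<^sub>2\<close> flip any single vertex. Below that, an element of \<open>K\<close> that fixes level \<open>n\<close> flips an even
  number of vertices of level \<open>n\<close> in each subtree of depth \<open>k + 2\<close>. The commutators \<open>[g, b\<^sub>2]\<close> flip pairs of
  vertices of level \<open>k + 2\<close>, and they can be transplanted to any subtree because \<open>H\<close> is regular branch
  over its commutator subgroup.

  Since \<open>H\<close> is everything up to level \<open>k + 3\<close>, no smaller pattern size is possible. The conditions cut the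
  pairs \<open>(h\<^sub>0, h\<^sub>1)\<close> in \<open>K\<close> down by a factor of four, so \<open>2|K(n+1)| = |K(n)|\<^sup>2\<close> for \<open>n \<ge> k + 3\<close>, which gives the
  Hausdorff dimension.
\<close>

subsection \<open>Tree automorphisms and wreath recursion\<close>

text \<open>The recursion with root flip \<open>e\<close>; \<open>x \<noteq> e\<close> is addition
  in Z/2. As in \<open>sect\<close>, sections are indexed by the letter before the flip.\<close>

definition wreath :: "bool \<Rightarrow> (bool \<Rightarrow> tmap) \<Rightarrow> tmap" where
  "wreath e G w = (case w of [] \<Rightarrow> [] | x # v \<Rightarrow> (x \<noteq> e) # G x v)"

lemma wreath_simps [simp]: "wreath e G [] = []" "wreath e G (x # v) = (x \<noteq> e) # G x v"
  by (simp_all add: wreath_def)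

lemma wreath_eq_iff [simp]: "wreath e G = wreath f F \<longleftrightarrow> e = f \<and> G = F"
proof
  assume eq: "wreath e G = wreath f F"
  have h: "(x \<noteq> e) # G x v = (x \<noteq> f) # F x v" for x v
    using fun_cong [OF eq, of "x # v"] by simp
  then show "e = f \<and> G = F" by (auto simp: fun_eq_iff)
qed simp

lemma wreath_comp: "wreath e G \<circ> wreath f F = wreath (e \<noteq> f) (\<lambda>x. G (x \<noteq> f) \<circ> F x)"
proof
  fix w show "(wreath e G \<circ> wreath f F) w = wreath (e \<noteq> f) (\<lambda>x. G (x \<noteq> f) \<circ> F x) w"
    by (cases w) auto
qed

lemma wreath_id [simp]: "wreath False (\<lambda>x. id) = id"
proof
  fix w show "wreath False (\<lambda>x. id) w = id w" by (cases w) auto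
qed

lemma wreath_eq_id_iff [simp]: "wreath e G = id \<longleftrightarrow> \<not> e \<and> (\<forall>x. G x = id)"
  using wreath_eq_iff [of e G False "\<lambda>x. id"] by (auto simp: fun_eq_iff)

lemma sect_wreath [simp]: "sect (wreath e G) [x] = G x"
  by (simp add: sect_def)

lemma sect_Nil [simp]: "sect g [] = g"
  by (simp add: sect_def)

lemma sect_Cons: "sect g (x # w) = sect (sect g [x]) w"
  by (simp add: sect_def)

lemma sect_append: "sect g (u @ w) = sect (sect g u) w"
  by (simp add: sect_def add.commute)

lemma sect_wreath_Cons [simp]: "sect (wreath e G) (x # w) = sect (G x) w"
  by (simp add: sect_Cons [of _ x w])

lemma Aut_iff: "g \<in> Aut \<longleftrightarrow> tree_aut g"
  by (simp add: Aut_def)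

lemma Aut_bij: "g \<in> Aut \<Longrightarrow> bij g"
  by (simp add: Aut_def tree_aut_def)

lemma Aut_length: "g \<in> Aut \<Longrightarrow> length (g w) = length w"
  by (simp add: Aut_def tree_aut_def)

lemma Aut_Nil: "g \<in> Aut \<Longrightarrow> g [] = []"
  using Aut_length [of g "[]"] by simp

lemma Aut_append: "g \<in> Aut \<Longrightarrow> g (w @ v) = g w @ sect g w v"
  by (metis Aut_iff append_take_drop_id sect_def tree_aut_def)

lemma Aut_inv_apply:
  assumes "g \<in> Aut" shows "g (inv g w) = w" "inv g (g w) = w"
  using Aut_bij [OF assms] by (simp_all add: bij_def surj_f_inv_f)

lemma Aut_inv_comp [simp]:
  assumes "g \<in> Aut" shows "g \<circ> inv g = id" "inv g \<circ> g = id"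
  by (simp_all add: fun_eq_iff Aut_inv_apply [OF assms])

lemma Aut_id [simp]: "id \<in> Aut"
  by (simp add: Aut_def tree_aut_def)

lemma Aut_comp [simp]: "g \<in> Aut \<Longrightarrow> h \<in> Aut \<Longrightarrow> g \<circ> h \<in> Aut"
  unfolding Aut_def tree_aut_def
  by (auto simp: bij_comp) (metis append_eq_conv_conj append_take_drop_id)

lemma Aut_inv [simp]: assumes "g \<in> Aut" shows "inv g \<in> Aut"
proof -
  have len: "length (inv g w) = length w" for w
    using Aut_length [OF assms, of "inv g w"] by (simp add: Aut_inv_apply [OF assms])
  have "take (length w) (inv g (w @ v)) = inv g w" for w v
  proof -
    define u where "u = inv g (w @ v)"
    \<comment> \<open>Comparing prefixes of length \<open>length w\<close> on both sides shows that
      \<open>g\<close> sends the prefix of \<open>u\<close> to \<open>w\<close>.\<close>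
    have "g (take (length w) u @ drop (length w) u) = w @ v"
      by (simp add: u_def Aut_inv_apply [OF assms])
    then have "g (take (length w) u) @ sect g (take (length w) u) (drop (length w) u) = w @ v"
      by (simp only: Aut_append [OF assms])
    moreover have "length (g (take (length w) u)) = length w"
      using len [of "w @ v"] by (simp add: u_def Aut_length [OF assms])
    ultimately have "g (take (length w) u) = w" by simp
    then have "inv g (g (take (length w) u)) = inv g w" by (rule arg_cong)
    then show ?thesis by (simp add: u_def Aut_inv_apply [OF assms])
  qed
  then show ?thesis
    using len Aut_bij [OF assms] by (simp add: Aut_def tree_aut_def bij_imp_bij_inv)
qed

lemma wreath_Aut [simp]: "wreath e G \<in> Aut \<longleftrightarrow> (\<forall>x. G x \<in> Aut)"
proof
  assume A: "wreath e G \<in> Aut"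
  show "\<forall>x. G x \<in> Aut"
  proof
    fix x
    have len: "length (G x v) = length v" for v
      using Aut_length [OF A, of "x # v"] by simp
    have "inj (G x)"
    proof (rule injI)
      fix v w assume "G x v = G x w"
      then have "wreath e G (x # v) = wreath e G (x # w)" by simp
      then have "x # v = x # w" using Aut_bij [OF A] by (simp add: bij_def inj_eq del: wreath_simps)
      then show "v = w" by simp
    qed
    moreover have "\<exists>v. G x v = w" for w
    proof -
      let ?u = "inv (wreath e G) ((x \<noteq> e) # w)"
      have u: "wreath e G ?u = (x \<noteq> e) # w" by (rule Aut_inv_apply [OF A])
      then show ?thesis by (cases ?u) auto
    qed
    moreover have "take (length w) (G x (w @ v)) = G x w" for w v
    proof -
      have "take (length (x # w)) (wreath e G ((x # w) @ v)) = wreath e G (x # w)"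
        using A unfolding Aut_def tree_aut_def by blast
      then show ?thesis by simp
    qed
    ultimately show "G x \<in> Aut"
      using len by (auto simp: Aut_def tree_aut_def bij_def surj_def) metis
  qed
next
  assume A: "\<forall>x. G x \<in> Aut"
  have "inj (wreath e G)"
  proof (rule injI)
    fix v w assume "wreath e G v = wreath e G w"
    moreover have "inj (G x)" for x using A by (simp add: Aut_bij bij_is_inj)
    ultimately show "v = w" by (cases v; cases w; cases "hd v"; cases "hd w") (auto simp: inj_eq)
  qed
  moreover have "\<exists>v. wreath e G v = w" for w
  proof (cases w)
    case Nil then show ?thesis by (intro exI [of _ "[]"]) simp
  next
    case (Cons x v) then show ?thesis
      by (intro exI [of _ "(x \<noteq> e) # inv (G (x \<noteq> e)) v"])
        (auto simp: Aut_inv_apply [OF A [rule_format]])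
  qed
  moreover have "length (wreath e G w) = length w" for w
    by (cases w) (auto simp: Aut_length [OF A [rule_format]])
  moreover have "take (length w) (wreath e G (w @ v)) = wreath e G w" for w v
    by (cases w) (auto simp: Aut_append [OF A [rule_format]] Aut_length [OF A [rule_format]])
  ultimately show "wreath e G \<in> Aut"
    by (auto simp: Aut_def tree_aut_def bij_def surj_def) metis
qed

lemma Aut_eq_wreath:
  assumes "g \<in> Aut" shows "g = wreath (g [False] = [True]) (\<lambda>x. sect g [x])"
proof
  fix w show "g w = wreath (g [False] = [True]) (\<lambda>x. sect g [x]) w"
  proof (cases w)
    case Nil then show ?thesis by (simp add: Aut_Nil [OF assms])
  next
    case (Cons x v)
    have l: "length (g [y]) = 1" for y by (simp add: Aut_length [OF assms])
    \<comment> \<open>Injectivity on the one-letter words leaves only two possible actions there,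
      told apart by the image of \<open>[False]\<close>.\<close>
    have "g [False] \<noteq> g [True]"
      using Aut_inv_apply(2) [OF assms, of "[False]"] Aut_inv_apply(2) [OF assms, of "[True]"] by auto
    then have "g [x] = [x \<noteq> (g [False] = [True])]"
      using l [of False] l [of True] by (cases x) (auto simp: length_Suc_conv)
    then show ?thesis using Cons Aut_append [OF assms, of "[x]" v] by simp
  qed
qed

lemma Aut_cases:
  assumes "g \<in> Aut" obtains e G where "g = wreath e G" "\<And>x. G x \<in> Aut"
proof
  show eq: "g = wreath (g [False] = [True]) (\<lambda>x. sect g [x])" by (rule Aut_eq_wreath [OF assms])
  show "sect g [x] \<in> Aut" for x using assms eq wreath_Aut by metis
qed

lemma sect_Aut [simp]: "g \<in> Aut \<Longrightarrow> sect g w \<in> Aut"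
proof (induction w arbitrary: g)
  case (Cons x w)
  then obtain e G where "g = wreath e G" "\<And>x. G x \<in> Aut" by (auto elim: Aut_cases)
  then show ?case using Cons.IH by simp
qed simp

lemma sect_comp: "g \<in> Aut \<Longrightarrow> h \<in> Aut \<Longrightarrow> sect (g \<circ> h) w = sect g (h w) \<circ> sect h w"
  by (simp add: fun_eq_iff sect_def [of "g \<circ> h"] Aut_append [of h] Aut_append [of g] Aut_length)

section \<open>Restriction to finite levels\<close>

lemma restr_0 [simp]: "g \<in> Aut \<Longrightarrow> restr 0 g = id"
  by (auto simp: restr_def fun_eq_iff Aut_Nil)

lemma restr_id [simp]: "restr n id = id"
  by (auto simp: restr_def fun_eq_iff)

lemma sect_restr: "sect (restr (Suc n) g) [x] = restr n (sect g [x])"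
  by (auto simp: restr_def sect_def fun_eq_iff)

lemma restr_eq_iff: "restr n g = restr n h \<longleftrightarrow> (\<forall>w. length w \<le> n \<longrightarrow> g w = h w)"
  by (auto simp: restr_def fun_eq_iff)

lemma restr_eq_id_iff: "restr n g = id \<longleftrightarrow> (\<forall>w. length w \<le> n \<longrightarrow> g w = w)"
  by (auto simp: restr_def fun_eq_iff)

lemma restr_id_le: "restr n g = id \<Longrightarrow> m \<le> n \<Longrightarrow> restr m g = id"
  by (simp add: restr_eq_id_iff)

lemma restr_comp: "h \<in> Aut \<Longrightarrow> restr n (g \<circ> h) = restr n g \<circ> restr n h"
  by (auto simp: restr_def fun_eq_iff Aut_length)

lemma restr_comp_cong:
  "h \<in> Aut \<Longrightarrow> h' \<in> Aut \<Longrightarrow> restr n g = restr n g' \<Longrightarrow> restr n h = restr n h' \<Longrightarrow>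
    restr n (g \<circ> h) = restr n (g' \<circ> h')"
  by (simp add: restr_comp)

lemma restr_inv: 
  assumes "g \<in> Aut" shows "restr n (inv g) = inv (restr n g)"
proof (rule inv_unique_comp [symmetric])
  show "restr n g \<circ> restr n (inv g) = id" "restr n (inv g) \<circ> restr n g = id"
    using assms by (simp_all flip: restr_comp)
qed

lemma restr_Suc_wreath: "restr (Suc n) (wreath e G) = restr (Suc n) (wreath f F) \<longleftrightarrow>
    e = f \<and> (\<forall>x. restr n (G x) = restr n (F x))"
proof
  assume "e = f \<and> (\<forall>x. restr n (G x) = restr n (F x))"
  then show "restr (Suc n) (wreath e G) = restr (Suc n) (wreath f F)"
    by (auto simp: restr_eq_iff wreath_def split: list.split)
next
  assume h: "restr (Suc n) (wreath e G) = restr (Suc n) (wreath f F)"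
  then have "\<forall>x v. length v \<le> n \<longrightarrow> (x \<noteq> e) # G x v = (x \<noteq> f) # F x v"
    unfolding restr_eq_iff by (metis Suc_le_mono length_Cons wreath_simps(2))
  then show "e = f \<and> (\<forall>x. restr n (G x) = restr n (F x))"
    by (auto simp: restr_eq_iff) (metis le0 list.size(3))+
qed

lemma restr_Suc_wreath_id: "restr (Suc n) (wreath e G) = id \<longleftrightarrow> \<not> e \<and> (\<forall>x. restr n (G x) = id)"
  using restr_Suc_wreath [of n e G False "\<lambda>x. id"] by simp

lemma subgroup_Aut_subset: "is_subgroup_of A Aut \<Longrightarrow> g \<in> A \<Longrightarrow> g \<in> Aut"
  by (auto simp: is_subgroup_of_def)

lemma gen_subgroup_least:
  assumes "is_subgroup_of A C" "S \<subseteq> A" "g \<in> gen_subgroup S" shows "g \<in> A"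
  using assms(3) by induction (use assms(1,2) in \<open>unfold is_subgroup_of_def, blast+\<close>)

lemma is_subgroup_Aut: "is_subgroup_of Aut Aut"
  by (simp add: is_subgroup_of_def)

lemma gen_subgroup_is_subgroup: "S \<subseteq> Aut \<Longrightarrow> is_subgroup_of (gen_subgroup S) Aut"
  using gen_subgroup_least [OF is_subgroup_Aut]
  by (auto simp: is_subgroup_of_def intro: gen_subgroup.intros)

subsection \<open>Level parities and flips\<close>

text \<open>Induction leaves eta-expanded instances of \<^const>\<open>id\<close> and \<^const>\<open>comp\<close> in the goals;
  with these rules active the simplifier would unfold them.\<close>
declare id_apply [simp del] comp_apply [simp del]

fun level_parity :: "nat \<Rightarrow> tmap \<Rightarrow> bool" where
  "level_parity 0 g \<longleftrightarrow> g [False] = [True]"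
| "level_parity (Suc j) g \<longleftrightarrow> level_parity j (sect g [False]) \<noteq> level_parity j (sect g [True])"

lemma level_parity_0_wreath: "(\<And>x. G x \<in> Aut) \<Longrightarrow> level_parity 0 (wreath e G) = e"
  by (simp add: Aut_Nil)

lemma level_parity_id [simp]: "\<not> level_parity j id"
proof (induction j)
  case (Suc j)
  have "sect id [x] = id" for x by (auto simp: sect_def id_def)
  then have "\<not> level_parity (Suc j) id" by (simp only: level_parity.simps)
  then show ?case .
qed (simp add: id_def)

text \<open>A flip at a vertex of level \<open>j\<close> is visible only on words of length
  \<open>j + 1\<close>, hence the strict bound.\<close>

lemma level_parity_restr_cong:
  "restr n g = restr n h \<Longrightarrow> j < n \<Longrightarrow> level_parity j g = level_parity j h"
proof (induction j arbitrary: n g h)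
  case 0 then show ?case by (simp add: restr_eq_iff)
next
  case (Suc j)
  then obtain m where m: "n = Suc m" "j < m" by (cases n) auto
  have "restr m (sect g [x]) = restr m (sect h [x])" for x
    using Suc.prems(1) m(1) by (metis sect_restr)
  then have "level_parity j (sect g [x]) = level_parity j (sect h [x])" for x using Suc.IH m(2) by blast
  then show ?case by simp
qed

lemma level_parity_fixed: "restr n g = id \<Longrightarrow> j < n \<Longrightarrow> \<not> level_parity j g"
  using level_parity_restr_cong [of n g id j] by simp

text \<open>Sections of a product are products of sections, permuted by the root flip of
  \<open>h\<close>; a sum over both subtrees does not see the permutation.\<close>

lemma level_parity_comp: "g \<in> Aut \<Longrightarrow> h \<in> Aut \<Longrightarrow> level_parity j (g \<circ> h) = (level_parity j g \<noteq> level_parity j h)"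
proof (induction j arbitrary: g h)
  case 0
  then show ?case
    by (elim Aut_cases) (simp add: wreath_comp level_parity_0_wreath del: level_parity.simps(1))
next
  case (Suc j)
  obtain e G where "g = wreath e G" "\<And>x. G x \<in> Aut" using Suc.prems(1) by (auto elim: Aut_cases)
  moreover obtain f F where "h = wreath f F" "\<And>x. F x \<in> Aut" using Suc.prems(2) by (auto elim: Aut_cases)
  ultimately show ?case by (cases f) (auto simp: wreath_comp Suc.IH)
qed

lemma level_parity_inv: "g \<in> Aut \<Longrightarrow> level_parity j (inv g) = level_parity j g"
  using level_parity_comp [of g "inv g" j] by simp

text \<open>The label of a single vertex; \<open>level_parity\<close> is the sum of these labels
  over a level.\<close>

definition flips :: "tmap \<Rightarrow> word \<Rightarrow> bool" where
  "flips g w = level_parity 0 (sect g w)"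

lemma flips_Cons [simp]: "flips (wreath e G) (x # w) = flips (G x) w"
  by (simp add: flips_def)

lemma flips_sect: "flips (sect g [x]) w = flips g (x # w)"
  by (simp add: flips_def sect_Cons [of g x w])

lemma flips_id [simp]: "\<not> flips id w"
  by (auto simp: flips_def sect_def id_def)

lemma flips_comp: "g \<in> Aut \<Longrightarrow> h \<in> Aut \<Longrightarrow> flips (g \<circ> h) w = (flips g (h w) \<noteq> flips h w)"
  by (simp only: flips_def sect_comp level_parity_comp sect_Aut)

text \<open>An element that is trivial down to level \<open>n\<close> is determined on the next
  level by its labels at level \<open>n\<close>.\<close>

lemma restr_Suc_eqI:
  assumes "g \<in> Aut" "h \<in> Aut" "restr n g = id" "restr n h = id"
    and "\<And>w. length w = n \<Longrightarrow> flips g w = flips h w"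
  shows "restr (Suc n) g = restr (Suc n) h"
  using assms
proof (induction n arbitrary: g h)
  case 0
  obtain e G where g: "g = wreath e G" "\<And>x. G x \<in> Aut" using 0(1) by (auto elim: Aut_cases)
  obtain f F where h: "h = wreath f F" "\<And>x. F x \<in> Aut" using 0(2) by (auto elim: Aut_cases)
  note m = g h
  then have "e = f" using 0(5) [of "[]"] by (simp add: flips_def level_parity_0_wreath del: level_parity.simps(1))
  then show ?case using m by (simp add: restr_Suc_wreath)
next
  case (Suc n)
  obtain e G where g: "g = wreath e G" "\<And>x. G x \<in> Aut" using Suc.prems(1) by (auto elim: Aut_cases)
  obtain f F where h: "h = wreath f F" "\<And>x. F x \<in> Aut" using Suc.prems(2) by (auto elim: Aut_cases)
  note m = g h
  have "restr (Suc n) (G x) = restr (Suc n) (F x)" for x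
  proof (rule Suc.IH)
    show "flips (G x) w = flips (F x) w" if "length w = n" for w
      using Suc.prems(5) [of "x # w"] that m by simp
  qed (use Suc.prems(3,4) m in \<open>auto simp: restr_Suc_wreath_id\<close>)
  then show ?case using Suc.prems m by (simp add: restr_Suc_wreath restr_Suc_wreath_id)
qed

text \<open>Since \<open>s\<close> fixes the vertex \<open>inv g w\<close>, the labels of
  \<open>g\<close> and \<open>inv g\<close> cancel and only that of \<open>s\<close>
  remains.\<close>

lemma flips_conj:
  assumes "g \<in> Aut" "s \<in> Aut" "restr n s = id" "length w = n"
  shows "flips (g \<circ> s \<circ> inv g) w = flips s (inv g w)"
proof -
  have "s (inv g w) = inv g w"
    using assms Aut_length [OF Aut_inv [OF assms(1)]] by (simp add: restr_eq_id_iff)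
  moreover have "flips g (inv g w) = flips (inv g) w"
    using flips_comp [of g "inv g" w] assms by simp
  ultimately show ?thesis using assms by (auto simp: flips_comp)
qed

lemma restr_conj:
  assumes "g \<in> Aut" "s \<in> Aut" "restr n s = id"
  shows "restr n (g \<circ> s \<circ> inv g) = id"
  using assms Aut_length [OF Aut_inv [OF assms(1)]]
  by (simp add: restr_eq_id_iff Aut_inv_apply comp_apply)

text \<open>The parity is the sum of all labels of the level, so the label at \<open>w0\<close> is
  determined by the parity and the other labels.\<close>

lemma flips_eq_if_level_parity_eq:
  assumes "g \<in> Aut" "h \<in> Aut" "level_parity n g = level_parity n h" "length w0 = n"
    and "\<And>w. length w = n \<Longrightarrow> w \<noteq> w0 \<Longrightarrow> flips g w = flips h w"
  shows "flips g w0 = flips h w0"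
proof -
  have same: "level_parity n g = level_parity n h" if "g \<in> Aut" "h \<in> Aut"
    "\<And>w. length w = n \<Longrightarrow> flips g w = flips h w" for n g h
    using that
  proof (induction n arbitrary: g h)
    case 0 then show ?case using 0(3) [of "[]"] by (simp add: flips_def)
  next
    case (Suc n)
    have "level_parity n (sect g [x]) = level_parity n (sect h [x])" for x
      using Suc.prems(3) [of "x # _"] Suc.prems(1,2)
      by (intro Suc.IH) (auto simp: flips_sect)
    then show ?case by simp
  qed
  show ?thesis using assms
  proof (induction n arbitrary: g h w0)
    case 0 then show ?case by (simp add: flips_def)
  next
    case (Suc n)
    obtain x v where w0: "w0 = x # v" "length v = n" using Suc.prems(4) by (cases w0) auto
    have "level_parity n (sect g [\<not> x]) = level_parity n (sect h [\<not> x])"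
      using Suc.prems(5) [of "(\<not> x) # _"] Suc.prems(1,2) w0
      by (intro same) (auto simp: flips_sect)
    then have "level_parity n (sect g [x]) = level_parity n (sect h [x])"
      using Suc.prems(3) by (cases x) auto
    then have "flips (sect g [x]) v = flips (sect h [x]) v"
      using Suc.prems(5) [of "x # _"] Suc.prems(1,2) w0
      by - (rule Suc.IH, auto simp: flips_sect)
    then show ?case using w0 by (simp add: flips_sect)
  qed
qed

text \<open>On elements fixing level \<open>n\<close> labels add vertex by vertex, so any label
  pattern is a product of elements that flip one vertex each. Labels on \<open>A\<close> are left
  uncontrolled; this serves the commutator subgroup, where only pairs can be flipped.\<close>

lemma flips_realised:
  assumes N: "id \<in> N" "\<And>g h. g \<in> N \<Longrightarrow> h \<in> N \<Longrightarrow> g \<circ> h \<in> N" "N \<subseteq> Aut"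
    and single: "\<And>w. length w = n \<Longrightarrow> w \<notin> A \<Longrightarrow>
      \<exists>c\<in>N. restr n c = id \<and> (\<forall>v. length v = n \<longrightarrow> v \<notin> A \<longrightarrow> flips c v = (v = w))"
  shows "\<exists>h\<in>N. restr n h = id \<and> (\<forall>w. length w = n \<longrightarrow> w \<notin> A \<longrightarrow> flips h w = flips t w)"
proof -
  let ?L = "{w. length w = n \<and> w \<notin> A \<and> flips t w}"
  have "finite {w :: word. length w = n}"
    using finite_lists_length_eq [of "UNIV :: bool set" n] by simp
  then have fin: "finite ?L" by (rule rev_finite_subset) auto
  have "\<exists>h\<in>N. restr n h = id \<and> (\<forall>w. length w = n \<longrightarrow> w \<notin> A \<longrightarrow> flips h w = (w \<in> F))"
    if "finite F" "F \<subseteq> ?L" for F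
    using that
  proof (induction F)
    case empty
    show ?case by (rule bexI [OF _ N(1)]) (simp only: restr_id flips_id empty_iff simp_thms)
  next
    case (insert u F)
    then obtain h where h: "h \<in> N" "restr n h = id"
      "\<forall>w. length w = n \<longrightarrow> w \<notin> A \<longrightarrow> flips h w = (w \<in> F)" by auto
    obtain c where c: "c \<in> N" "restr n c = id"
      "\<forall>v. length v = n \<longrightarrow> v \<notin> A \<longrightarrow> flips c v = (v = u)"
      using single [of u] insert.prems by auto
    have a: "c \<in> Aut" "h \<in> Aut" using N(3) h c by auto
    have "restr n (c \<circ> h) = id" using a h c by (simp add: restr_comp)
    moreover have "flips (c \<circ> h) w = (w \<in> insert u F)" if "length w = n" "w \<notin> A" for w
    proof -
      have "h w = w" using h(2) that by (simp add: restr_eq_id_iff)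
      then show ?thesis using a h(3) c(3) that insert.hyps(2)
        by (auto simp: flips_comp)
    qed
    ultimately show ?case using N(2) h(1) c(1) by blast
  qed
  from this [OF fin] show ?thesis by auto
qed

lemma inv_wreath: "(\<And>x. G x \<in> Aut) \<Longrightarrow> inv (wreath e G) = wreath e (\<lambda>x. inv (G (x \<noteq> e)))"
proof (rule inv_unique_comp)
  assume G: "\<And>x. G x \<in> Aut"
  have "((x \<noteq> e) \<noteq> e) = x" for x by auto
  with G show "wreath e G \<circ> wreath e (\<lambda>x. inv (G (x \<noteq> e))) = id" "wreath e (\<lambda>x. inv (G (x \<noteq> e))) \<circ> wreath e G = id"
    by (simp_all only: wreath_comp wreath_eq_id_iff Aut_inv_comp) auto
qed

subsection \<open>Commutators\<close>

lemma inv_comp: "g \<in> Aut \<Longrightarrow> h \<in> Aut \<Longrightarrow> inv (g \<circ> h) = inv h \<circ> inv g"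
  by (simp add: o_inv_distrib Aut_bij)

lemma inv_inv_Aut: "g \<in> Aut \<Longrightarrow> inv (inv g) = g"
  by (simp add: inv_inv_eq Aut_bij)

lemma Aut_cancel [simp]: "g \<in> Aut \<Longrightarrow> g \<circ> (inv g \<circ> h) = h" "g \<in> Aut \<Longrightarrow> inv g \<circ> (g \<circ> h) = h"
  by (simp_all flip: comp_assoc)

text \<open>The element \<open>(g, h)\<close> that fixes the first level, with \<open>g\<close>
  acting below 0 and \<open>h\<close> below 1.\<close>

definition pair :: "tmap \<Rightarrow> tmap \<Rightarrow> tmap" where
  "pair g h = wreath False (\<lambda>x. if x then h else g)"

lemma pair_comp: "pair g h \<circ> pair g' h' = pair (g \<circ> g') (h \<circ> h')"
  by (auto simp: pair_def wreath_comp intro!: ext)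

lemma pair_Aut [simp]: "pair g h \<in> Aut \<longleftrightarrow> g \<in> Aut \<and> h \<in> Aut"
  by (auto simp: pair_def split: if_splits)

lemma pair_id [simp]: "pair id id = id"
  by (simp add: pair_def)

lemma pair_inv: "g \<in> Aut \<Longrightarrow> h \<in> Aut \<Longrightarrow> inv (pair g h) = pair (inv g) (inv h)"
  by (auto simp: pair_def inv_wreath intro!: ext)

lemma wreath_False_eq_pair: "wreath False G = pair (G False) (G True)"
  by (auto simp: pair_def intro!: ext)

definition comm :: "tmap \<Rightarrow> tmap \<Rightarrow> tmap" where
  "comm g h = g \<circ> h \<circ> inv g \<circ> inv h"

lemma comm_Aut [simp]: "g \<in> Aut \<Longrightarrow> h \<in> Aut \<Longrightarrow> comm g h \<in> Aut"
  by (simp add: comm_def)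

lemma pair_comm:
  "g \<in> Aut \<Longrightarrow> h \<in> Aut \<Longrightarrow> g' \<in> Aut \<Longrightarrow> h' \<in> Aut \<Longrightarrow>
    comm (pair g h) (pair g' h') = pair (comm g g') (comm h h')"
  by (simp add: comm_def pair_inv pair_comp)

lemma comm_id [simp]: "g \<in> Aut \<Longrightarrow> comm id g = id" "g \<in> Aut \<Longrightarrow> comm g id = id"
  by (simp_all add: comm_def inv_id)

lemma comm_self [simp]: "g \<in> Aut \<Longrightarrow> comm g g = id"
  by (simp add: comm_def comp_assoc)

lemma inv_comm: "g \<in> Aut \<Longrightarrow> h \<in> Aut \<Longrightarrow> inv (comm g h) = comm h g"
  by (simp add: comm_def inv_comp inv_inv_Aut comp_assoc)

lemma comm_comp: 
  "f \<in> Aut \<Longrightarrow> g \<in> Aut \<Longrightarrow> h \<in> Aut \<Longrightarrow> comm (f \<circ> g) h = (f \<circ> comm g h \<circ> inv f) \<circ> comm f h"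
  by (simp add: comm_def inv_comp comp_assoc)

lemma comm_inv: 
  "g \<in> Aut \<Longrightarrow> h \<in> Aut \<Longrightarrow> comm (inv g) h = inv g \<circ> inv (comm g h) \<circ> inv (inv g)"
  by (simp add: comm_def inv_comp inv_inv_Aut comp_assoc)

lemma conj_comm: 
  "f \<in> Aut \<Longrightarrow> g \<in> Aut \<Longrightarrow> h \<in> Aut \<Longrightarrow>
    f \<circ> comm g h \<circ> inv f = comm (f \<circ> g \<circ> inv f) (f \<circ> h \<circ> inv f)"
  by (simp add: comm_def inv_comp inv_inv_Aut comp_assoc)

text \<open>Modulo a normal subgroup containing the commutators of the generators, the generators
  commute, hence so does the whole group.\<close>

lemma gen_subgroup_comm_subset:
  assumes S: "S \<subseteq> Aut"
    and N: "id \<in> N" "\<And>g h. g \<in> N \<Longrightarrow> h \<in> N \<Longrightarrow> g \<circ> h \<in> N" "\<And>g. g \<in> N \<Longrightarrow> inv g \<in> N"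
    and conj: "\<And>g f. g \<in> N \<Longrightarrow> f \<in> gen_subgroup S \<Longrightarrow> f \<circ> g \<circ> inv f \<in> N"
    and gens: "\<And>s t. s \<in> S \<Longrightarrow> t \<in> S \<Longrightarrow> comm s t \<in> N"
    and g: "g \<in> gen_subgroup S" and h: "h \<in> gen_subgroup S"
  shows "comm g h \<in> N"
proof -
  have Aut: "f \<in> Aut" if "f \<in> gen_subgroup S" for f
    using that S gen_subgroup_least [OF is_subgroup_Aut] by blast
  \<comment> \<open>First the left argument is extended from generators to the whole group, then
    inversion exchanges the two arguments.\<close>
  have ext: "comm f t \<in> N" if "f \<in> gen_subgroup S" "t \<in> Aut" "\<And>s. s \<in> S \<Longrightarrow> comm s t \<in> N" for f t
    using that(1)
  proof induction
    case gen_id show ?case using that(2) N(1) by simp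
  next
    case (gen_el s) then show ?case by (rule that(3))
  next
    case (gen_comp f g)
    then show ?case using that(2) by (simp add: comm_comp Aut N(2) conj)
  next
    case (gen_inv g)
    then show ?case using that(2) by (simp add: comm_inv Aut N(3) conj gen_subgroup.gen_inv)
  qed
  have "comm s h \<in> N" if "s \<in> S" for s
  proof -
    have s: "s \<in> Aut" using S that by auto
    then have "comm h s \<in> N" using that by (intro ext [OF h]) (auto intro: gens)
    then have "inv (comm h s) \<in> N" by (rule N(3))
    then show ?thesis using s Aut [OF h] by (simp add: inv_comm)
  qed
  then show ?thesis using ext [OF g Aut [OF h]] by blast
qed

subsection \<open>The group generated by the automaton\<close>

lemma act_wreath: "act k s = wreath (flip s) (\<lambda>x. act k (child k s x))"
proof
  fix w show "act k s w = wreath (flip s) (\<lambda>x. act k (child k s x)) w" by (cases w) auto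
qed

lemma act_E [simp]: "act k E = id"
proof
  fix w show "act k E w = id w" by (induction w) (auto simp: id_def)
qed

text \<open>Only \<open>R 0\<close> changes a letter, and its sections are trivial; every other
  state keeps the letter and passes to the same child both times.\<close>

lemma act_involution: "act k s (act k s w) = w"
proof (induction w arbitrary: s)
  case (Cons x w)
  show ?case
  proof (cases "s = R 0")
    case False
    then have "\<not> flip s" by (cases s rule: flip.cases) auto
    then show ?thesis using Cons by simp
  qed (simp add: id_def)
qed simp

lemma act_Aut [simp]: "act k s \<in> Aut"
proof -
  have "bij (act k s)" by (rule o_bij [of "act k s"]) (auto simp: fun_eq_iff comp_apply act_involution id_def)
  moreover have "length (act k s w) = length w" for w
    by (induction w arbitrary: s) auto
  moreover have "take (length w) (act k s (w @ v)) = act k s w" for w v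
    by (induction w arbitrary: s) auto
  ultimately show ?thesis by (simp add: Aut_def tree_aut_def)
qed

lemma act_R_0: "act k (R 0) = wreath True (\<lambda>x. id)"
  by (simp add: act_wreath [of k "R 0"])

lemma act_R_Suc: "act k (R (Suc i)) = pair (act k (R i)) id"
  by (auto simp: act_wreath [of k "R (Suc i)"] pair_def intro!: ext)

lemma act_B:
  shows "act k (B 0) = pair (act k (R k)) (act k (B 1))"
    and "act k (B 1) = pair (act k (R k)) (act k (B 2))"
    and "act k (B 2) = pair id (act k (B 0))"
  by (subst act_wreath, simp add: pair_def, rule ext, simp)+

lemma inv_act: "inv (act k s) = act k s"
  by (rule inv_unique_comp) (auto simp: fun_eq_iff comp_apply act_involution id_def)

lemma gens_Aut: "gens k \<subseteq> Aut"
  by (auto simp: gens_def)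

lemma Hgrp_subgroup: "is_subgroup_of (Hgrp k) Aut"
  unfolding Hgrp_def by (rule gen_subgroup_is_subgroup [OF gens_Aut])

lemma Hgrp_Aut: "g \<in> Hgrp k \<Longrightarrow> g \<in> Aut"
  using Hgrp_subgroup subgroup_Aut_subset by blast

lemma Hgrp_closed:
  "id \<in> Hgrp k" "g \<in> Hgrp k \<Longrightarrow> h \<in> Hgrp k \<Longrightarrow> g \<circ> h \<in> Hgrp k" "g \<in> Hgrp k \<Longrightarrow> inv g \<in> Hgrp k"
  by (auto simp: Hgrp_def intro: gen_subgroup.intros)

lemma R_Hgrp: "i \<le> k \<Longrightarrow> act k (R i) \<in> Hgrp k"
  by (auto simp: Hgrp_def gens_def intro: gen_subgroup.gen_el)

lemma B_Hgrp: "j < 3 \<Longrightarrow> act k (B j) \<in> Hgrp k"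
  by (auto simp: Hgrp_def gens_def intro: gen_subgroup.gen_el)

lemma gens_cases:
  assumes "s \<in> gens k"
  obtains i where "i < k" "s = act k (R i)" | "s = act k (R k)"
    | "s = act k (B 0)" | "s = act k (B 1)" | "s = act k (B 2)"
proof -
  consider i where "i \<le> k" "s = act k (R i)" | j where "j < 3" "s = act k (B j)"
    using assms by (auto simp: gens_def)
  then show thesis
  proof cases
    case (1 i) then show thesis using that(1) [of i] that(2) by (cases "i = k") auto
  next
    case (2 j)
    then consider "j = 0" | "j = 1" | "j = 2" by linarith
    then show thesis using 2 that(3-5) by cases auto
  qed
qed

lemma swap_pair: "act k (R 0) \<circ> pair g h \<circ> act k (R 0) = pair h g"
  by (auto simp: act_R_0 pair_def wreath_comp intro!: ext)

lemma Hgrp_swap: 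
  assumes "pair g h \<in> Hgrp k" shows "pair h g \<in> Hgrp k"
proof -
  have "act k (R 0) \<circ> pair g h \<circ> act k (R 0) \<in> Hgrp k"
    by (intro Hgrp_closed R_Hgrp assms) auto
  then show ?thesis by (simp only: swap_pair)
qed

lemma R_lift: "i < k \<Longrightarrow> pair id (act k (R i)) \<in> Hgrp k"
  using R_Hgrp [of "Suc i" k] by (simp add: act_R_Suc Hgrp_swap)

lemma B_lift:
  "pair (act k (R k)) (act k (B 1)) \<in> Hgrp k" "pair (act k (R k)) (act k (B 2)) \<in> Hgrp k"
  "pair id (act k (B 0)) \<in> Hgrp k"
  using B_Hgrp [of 0 k, unfolded act_B(1)] B_Hgrp [of 1 k, unfolded act_B(2)]
    B_Hgrp [of 2 k, unfolded act_B(3)] by simp_all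

text \<open>\<open>H\<close> is self-replicating: every generator occurs as a coordinate of a
  generator that fixes the first level, and conjugation by \<open>R 0\<close> moves it to the
  coordinate 1. The other coordinate \<open>y\<close> is irrelevant for later use.\<close>

lemma Hgrp_lift:
  assumes "g \<in> Hgrp k" shows "\<exists>y\<in>Aut. pair y g \<in> Hgrp k"
  using assms unfolding Hgrp_def
proof induction
  case gen_id
  show ?case using Hgrp_closed(1) [of k, unfolded Hgrp_def] by (intro bexI [of _ id]) simp_all
next
  case (gen_el s)
  have "\<exists>y\<in>Aut. pair y s \<in> Hgrp k"
    using gen_el
  proof (cases rule: gens_cases)
    case (1 i) then show ?thesis using R_lift by (intro bexI [of _ id]) simp_all
  next
    \<comment> \<open>\<open>R k\<close> is the left coordinate of \<open>B 0\<close>, so the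
      coordinates are exchanged here.\<close>
    case 2 then show ?thesis using Hgrp_swap [OF B_lift(1)] by (intro bexI [of _ "act k (B 1)"]) simp_all
  next
    case 3 then show ?thesis using B_lift(3) by (intro bexI [of _ id]) simp_all
  next
    case 4 then show ?thesis using B_lift(1) by (intro bexI [of _ "act k (R k)"]) simp_all
  next
    case 5 then show ?thesis using B_lift(2) by (intro bexI [of _ "act k (R k)"]) simp_all
  qed
  then show ?case by (simp add: Hgrp_def)
next
  case (gen_comp g h)
  then obtain y z where "y \<in> Aut" "z \<in> Aut" "pair y g \<in> gen_subgroup (gens k)"
    "pair z h \<in> gen_subgroup (gens k)" by blast
  then show ?case
    by (intro bexI [of _ "y \<circ> z"]) (auto simp flip: pair_comp intro: gen_subgroup.gen_comp)
next
  case (gen_inv g)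
  then obtain y where y: "y \<in> Aut" "pair y g \<in> gen_subgroup (gens k)" by blast
  moreover have "g \<in> Aut" using gen_inv Hgrp_Aut by (simp add: Hgrp_def)
  ultimately show ?case
    by (intro bexI [of _ "inv y"]) (auto simp flip: pair_inv intro: gen_subgroup.gen_inv)
qed

text \<open>Self-replication moves the tail of a word as wished, and \<open>R 0\<close> then
  corrects its first letter.\<close>

lemma Hgrp_transitive: "length v = length w \<Longrightarrow> \<exists>h\<in>Hgrp k. h v = w"
proof (induction v w rule: list_induct2)
  case Nil
  show ?case using Hgrp_closed(1) by (intro bexI [of _ id]) (simp_all add: id_def)
next
  case (Cons x v y w)
  then obtain g where g: "g \<in> Hgrp k" "g v = w" by blast
  obtain z where z: "pair z g \<in> Hgrp k" using Hgrp_lift [OF g(1)] by blast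
  define f where "f = (if x then pair z g else pair g z)"
  have f: "f \<in> Hgrp k" "f (x # v) = x # w"
    using z g(2) Hgrp_swap by (auto simp: f_def pair_def)
  show ?case
  proof (cases "x = y")
    case False
    then have "(act k (R 0) \<circ> f) (x # v) = y # w"
      using f(2) by (simp add: comp_apply id_def)
    then show ?thesis using Hgrp_closed(2) [OF R_Hgrp f(1), of 0] by blast
  qed (use f in blast)
qed

section \<open>The commutator subgroup of H\<close>

definition Dgrp :: "nat \<Rightarrow> tmap set" where
  "Dgrp k = gen_subgroup {comm g h | g h. g \<in> Hgrp k \<and> h \<in> Hgrp k}"

lemma comm_Dgrp: "g \<in> Hgrp k \<Longrightarrow> h \<in> Hgrp k \<Longrightarrow> comm g h \<in> Dgrp k"
  unfolding Dgrp_def by (rule gen_subgroup.gen_el) blast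

lemma Dgrp_closed:
  "id \<in> Dgrp k" "g \<in> Dgrp k \<Longrightarrow> h \<in> Dgrp k \<Longrightarrow> g \<circ> h \<in> Dgrp k" "g \<in> Dgrp k \<Longrightarrow> inv g \<in> Dgrp k"
  by (auto simp: Dgrp_def intro: gen_subgroup.intros)

lemma Dgrp_Hgrp: assumes "g \<in> Dgrp k" shows "g \<in> Hgrp k"
proof (rule gen_subgroup_least [OF Hgrp_subgroup _ assms [unfolded Dgrp_def]])
  show "{comm g h | g h. g \<in> Hgrp k \<and> h \<in> Hgrp k} \<subseteq> Hgrp k"
    by (auto simp: comm_def intro!: Hgrp_closed)
qed

lemma Dgrp_Aut: "g \<in> Dgrp k \<Longrightarrow> g \<in> Aut"
  by (rule Hgrp_Aut [OF Dgrp_Hgrp])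

lemma Dgrp_conj:
  assumes "g \<in> Dgrp k" "f \<in> Hgrp k" shows "f \<circ> g \<circ> inv f \<in> Dgrp k"
proof -
  have f: "f \<in> Aut" using assms(2) by (rule Hgrp_Aut)
  show ?thesis using assms(1) [unfolded Dgrp_def]
  proof induction
    case gen_id then show ?case using f Dgrp_closed(1) by simp
  next
    case (gen_el s)
    then obtain g h where "s = comm g h" "g \<in> Hgrp k" "h \<in> Hgrp k" by blast
    then show ?case using f assms(2)
      by (simp add: conj_comm Hgrp_Aut) (intro comm_Dgrp Hgrp_closed)
  next
    case (gen_comp g h)
    have "(f \<circ> g \<circ> inv f) \<circ> (f \<circ> h \<circ> inv f) \<in> Dgrp k" by (intro Dgrp_closed gen_comp)
    then show ?case using f by (simp add: comp_assoc)
  next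
    case (gen_inv g)
    have "g \<in> Aut" using gen_inv Dgrp_Aut by (simp add: Dgrp_def)
    moreover have "inv (f \<circ> g \<circ> inv f) \<in> Dgrp k" by (intro Dgrp_closed gen_inv)
    ultimately show ?case using f by (simp add: inv_comp inv_inv_Aut comp_assoc)
  qed
qed

subsection \<open>Branching over the commutator subgroup\<close>

text \<open>Below the letter 0 both sections lie in the commuting set consisting of
  \<open>act k (R k)\<close> and \<open>id\<close>; below the letter 1 they are again of the form
  \<open>act k (B _)\<close>, and the induction applies.\<close>

lemma B_commute: "act k (B i) (act k (B j) w) = act k (B j) (act k (B i) w)"
  by (induction w arbitrary: i j) (auto simp: id_def)

text \<open>Every commutator of generators is, up to inversion, of the form \<open>[x, z]\<close> with \<open>(1, x)\<close> in \<open>H\<close>,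
  because \<open>[r\<^sub>k, b\<^sub>1] = [r\<^sub>k, b\<^sub>0]\<close>; then \<open>(1, [x, z])\<close> is the commutator of \<open>(1, x)\<close>
  and any lift of \<open>z\<close>.\<close>
lemma Dgrp_lift:
  assumes k: "k \<ge> 1" and d: "d \<in> Dgrp k" shows "pair id d \<in> Dgrp k"
proof -
  \<comment> \<open>\<open>N\<close> is normalised by \<open>H\<close>, because any lift of an
    element of \<open>H\<close> conjugates \<open>(1, t)\<close> inside the normal subgroup
    \<open>Dgrp k\<close>. It thus suffices to place the commutators of generators in
    \<open>N\<close>.\<close>
  define N where "N = {t \<in> Aut. pair id t \<in> Dgrp k}"
  have N1: "id \<in> N" using Dgrp_closed(1) by (simp add: N_def)
  have N2: "g \<circ> h \<in> N" if "g \<in> N" "h \<in> N" for g h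
    using that Dgrp_closed(2) [of "pair id g" k "pair id h"] by (simp add: N_def pair_comp)
  have N3: "inv g \<in> N" if "g \<in> N" for g
    using that Dgrp_closed(3) [of "pair id g" k] by (simp add: N_def pair_inv inv_id)
  have N_conj: "f \<circ> g \<circ> inv f \<in> N" if "g \<in> N" and fH: "f \<in> Hgrp k" for f g
  proof -
    obtain y where y: "y \<in> Aut" "pair y f \<in> Hgrp k" using Hgrp_lift [OF fH] by blast
    have f: "f \<in> Aut" by (rule Hgrp_Aut [OF that(2)])
    have "pair y f \<circ> pair id g \<circ> inv (pair y f) \<in> Dgrp k"
      using that(1) by (intro Dgrp_conj y) (simp add: N_def)
    then show ?thesis using y(1) f that(1) by (simp add: N_def pair_inv pair_comp)
  qed
  have good: "comm s t \<in> N \<and> comm t s \<in> N" if "pair id s \<in> Hgrp k" and tH: "t \<in> Hgrp k" for s t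
  proof -
    obtain y where y: "y \<in> Aut" "pair y t \<in> Hgrp k" using Hgrp_lift [OF tH] by blast
    have st: "s \<in> Aut" "t \<in> Aut" using Hgrp_Aut [OF that(1)] Hgrp_Aut [OF that(2)] by simp_all
    have "comm (pair id s) (pair y t) \<in> Dgrp k" by (rule comm_Dgrp [OF that(1) y(2)])
    then have "comm s t \<in> N" using st y(1) by (simp add: N_def pair_comm)
    moreover from N3 [OF this] have "comm t s \<in> N" using st by (simp add: inv_comm)
    ultimately show ?thesis ..
  qed
  obtain l where l: "k = Suc l" using k by (cases k) auto
  have Rk: "act k (R k) = pair (act k (R l)) id" by (simp add: l act_R_Suc)
  \<comment> \<open>As \<open>k \<ge> 1\<close>, \<open>R k\<close> is trivial below 1, so only the
    left coordinates matter, and \<open>B 0\<close> and \<open>B 1\<close> have the same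
    one.\<close>
  have "comm (act k (R k)) (act k (B 1)) = comm (act k (R k)) (act k (B 0))"
    unfolding act_B(1,2) by (subst (1 3) Rk) (simp add: pair_comm)
  moreover have "comm (act k (R k)) (act k (B 0)) \<in> N"
    using good [OF B_lift(3) R_Hgrp] by simp
  ultimately have RB1: "comm (act k (R k)) (act k (B 1)) \<in> N" by simp
  \<comment> \<open>\<open>R k\<close> and \<open>B 2\<close> act on different halves of the tree
    and commute.\<close>
  have RB2: "comm (act k (R k)) (act k (B 2)) \<in> N"
    unfolding act_B(3) by (subst Rk) (simp add: pair_comm N1)
  have BB: "comm (act k (B i)) (act k (B j)) \<in> N" for i j
  proof -
    have "act k (B i) \<circ> act k (B j) = act k (B j) \<circ> act k (B i)"
      by (simp add: fun_eq_iff comp_apply B_commute [of k i j])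
    then have "comm (act k (B i)) (act k (B j)) = id"
      by (simp add: comm_def comp_assoc)
    then show ?thesis using N1 by simp
  qed
  have sym: "comm t s \<in> N" if "comm s t \<in> N" "s \<in> Aut" "t \<in> Aut" for s t
    using N3 [OF that(1)] that(2,3) by (simp add: inv_comm)
  have RB: "comm (act k (R k)) (act k (B j)) \<in> N \<and> comm (act k (B j)) (act k (R k)) \<in> N"
    if "j = 1 \<or> j = 2" for j
    using RB1 RB2 sym that by auto
  have RR: "comm (act k (R k)) (act k (R k)) \<in> N" using N1 by simp
  have gens: "comm s t \<in> N" if "s \<in> gens k" "t \<in> gens k" for s t
  proof -
    have sp: "pair id s \<in> Hgrp k \<or> s = act k (R k) \<or> s = act k (B 1) \<or> s = act k (B 2)"
      if "s \<in> gens k" for s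
      using that by (cases rule: gens_cases) (use R_lift B_lift(3) in auto)
    have H: "s \<in> Hgrp k" "t \<in> Hgrp k"
      using that by (auto simp: Hgrp_def intro: gen_subgroup.gen_el)
    show ?thesis
      using sp [OF that(1)] sp [OF that(2)] good H RB [of 1] RB [of 2] RR BB by fastforce
  qed
  have comm: "comm g h \<in> N" if "g \<in> Hgrp k" "h \<in> Hgrp k" for g h
    using gen_subgroup_comm_subset [OF gens_Aut N1 N2 N3 N_conj [unfolded Hgrp_def] gens] that
    unfolding Hgrp_def by blast
  have "is_subgroup_of N Aut"
    using N1 N2 N3 by (auto simp: is_subgroup_of_def N_def)
  moreover have "{comm g h | g h. g \<in> Hgrp k \<and> h \<in> Hgrp k} \<subseteq> N" using comm by blast
  ultimately have "d \<in> N" using d unfolding Dgrp_def by (rule gen_subgroup_least)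
  then show ?thesis by (simp add: N_def)
qed

lemma Dgrp_pair:
  assumes "k \<ge> 1" "c \<in> Dgrp k" "d \<in> Dgrp k" shows "pair c d \<in> Dgrp k"
proof -
  have "act k (R 0) \<circ> pair id c \<circ> inv (act k (R 0)) \<in> Dgrp k"
    by (intro Dgrp_conj Dgrp_lift assms R_Hgrp) simp
  then have "pair c id \<in> Dgrp k" by (simp only: inv_act swap_pair)
  then have "pair c id \<circ> pair id d \<in> Dgrp k" by (intro Dgrp_closed Dgrp_lift assms)
  then show ?thesis by (simp add: pair_comp)
qed

text \<open>A homomorphism to an abelian group kills commutators.\<close>

lemma level_parity_Dgrp: assumes "d \<in> Dgrp k" shows "\<not> level_parity j d"
proof -
  have "is_subgroup_of {g \<in> Aut. \<not> level_parity j g} Aut"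
    by (auto simp: is_subgroup_of_def level_parity_comp level_parity_inv)
  moreover have "{comm g h | g h. g \<in> Hgrp k \<and> h \<in> Hgrp k} \<subseteq> {g \<in> Aut. \<not> level_parity j g}"
    using Hgrp_Aut [of _ k] by (auto simp: comm_def level_parity_comp level_parity_inv)
  ultimately show ?thesis using assms unfolding Dgrp_def by (auto dest: gen_subgroup_least)
qed

subsection \<open>Realising flips\<close>

lemma flips_fixed: "restr (Suc n) g = id \<Longrightarrow> length w \<le> n \<Longrightarrow> \<not> flips g w"
  by (auto simp: flips_def sect_def restr_eq_id_iff)

definition single_flip :: "nat \<Rightarrow> word \<Rightarrow> tmap \<Rightarrow> bool" where
  "single_flip n w s \<longleftrightarrow> length w = n \<and> s \<in> Aut \<and> restr n s = id
     \<and> (\<forall>v. length v = n \<longrightarrow> flips s v = (v = w))"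

lemma single_flip_R: "single_flip j (replicate j False) (act k (R j))"
proof (induction j)
  case 0
  show ?case by (simp add: single_flip_def flips_def id_def)
next
  case (Suc j)
  have "flips (act k (R (Suc j))) v = (v = replicate (Suc j) False)" if "length v = Suc j" for v
    using that Suc by (cases v) (auto simp: single_flip_def act_R_Suc pair_def)
  then show ?case using Suc
    by (simp add: single_flip_def) (simp add: act_R_Suc pair_def restr_Suc_wreath_id)
qed

lemma R_stab: "restr j (act k (R j)) = id"
  using single_flip_R by (simp add: single_flip_def)

text \<open>Every \<open>R k\<close> met on the way sits at least one letter down and is itself
  trivial down to level \<open>k\<close>.\<close>

lemma B_stab: "n \<le> Suc k \<Longrightarrow> restr n (act k (B j)) = id"
proof (induction n arbitrary: j)
  case (Suc n)
  then have "restr n (act k (R k)) = id" "\<And>j. restr n (act k (B j)) = id"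
    using restr_id_le [OF R_stab] by auto
  then show ?case by (subst act_wreath) (auto simp: restr_Suc_wreath_id)
qed simp

lemma single_flip_B0: "single_flip (Suc k) (replicate (Suc k) False) (act k (B 0))"
proof -
  have "flips (act k (B 0)) v = (v = replicate (Suc k) False)" if v: "length v = Suc k" for v
  proof -
    obtain x u where v: "v = x # u" "length u = k" using v by (cases v) auto
    \<comment> \<open>The right half contributes no label: \<open>B 1\<close> is trivial down to
      level \<open>k + 1\<close>, one level below \<open>u\<close>.\<close>
    have "\<not> flips (act k (B 1)) u" by (rule flips_fixed [of k]) (use B_stab v in auto)
    then show ?thesis using single_flip_R [of k k] v
      by (auto simp: act_B(1) pair_def single_flip_def)
  qed
  then show ?thesis by (simp add: single_flip_def B_stab)
qed

lemma single_flip_B2: "single_flip (k + 2) (True # replicate (Suc k) False) (act k (B 2))"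
proof -
  have "flips (act k (B 2)) v = (v = True # replicate (Suc k) False)" if v: "length v = k + 2" for v
  proof -
    obtain x u where "v = x # u" "length u = Suc k" using v by (cases v) auto
    then show ?thesis using single_flip_B0 [of k]
      by (auto simp: act_B(3) pair_def single_flip_def)
  qed
  moreover have "restr (Suc (Suc k)) (act k (B 2)) = id"
    unfolding act_B(3) pair_def by (simp add: restr_Suc_wreath_id B_stab)
  ultimately show ?thesis by (simp add: single_flip_def)
qed

lemma single_flip_conj:
  assumes "single_flip n w s" "g \<in> Aut"
  shows "single_flip n (g w) (g \<circ> s \<circ> inv g)"
proof -
  have "inv g v = w \<longleftrightarrow> v = g w" for v using Aut_inv_apply [OF assms(2)] by auto
  moreover have "length (inv g v) = length v" for v by (simp add: Aut_length assms(2))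
  ultimately show ?thesis
    using assms by (auto simp: single_flip_def Aut_length restr_conj flips_conj [of g s n])
qed

text \<open>One element of \<open>H\<close> flipping a single vertex of level \<open>n\<close> is
  enough: transitivity conjugates it to every vertex of that level. Such a seed is
  \<open>R n\<close> for \<open>n \<le> k\<close>, then \<open>B 0\<close> and \<open>B 2\<close>
  for the next two levels.\<close>

lemma Hgrp_level_full:
  assumes "n \<le> k + 2" "t \<in> Aut" "restr n t = id"
  shows "\<exists>h\<in>Hgrp k. restr (Suc n) t = restr (Suc n) h"
proof -
  have "\<exists>s\<in>Hgrp k. \<exists>w. single_flip n w s"
  proof -
    consider "n \<le> k" | "n = Suc k" | "n = k + 2" using assms(1) by linarith
    then show ?thesis
    proof cases
      case 1 then show ?thesis using single_flip_R R_Hgrp by blast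
    next
      case 2 then show ?thesis using single_flip_B0 B_Hgrp [of 0] by force
    next
      case 3 then show ?thesis using single_flip_B2 B_Hgrp [of 2] by force
    qed
  qed
  then obtain s w where s: "s \<in> Hgrp k" "single_flip n w s" by blast
  have "\<exists>h\<in>Hgrp k. restr n h = id \<and> (\<forall>w. length w = n \<longrightarrow> w \<notin> {} \<longrightarrow> flips h w = flips t w)"
  proof (rule flips_realised)
    fix u :: word assume "length u = n"
    then obtain g where g: "g \<in> Hgrp k" "g w = u"
      using s(2) Hgrp_transitive [of w u k] by (auto simp: single_flip_def)
    have "single_flip n u (g \<circ> s \<circ> inv g)"
      using single_flip_conj [OF s(2) Hgrp_Aut [OF g(1)]] g(2) by simp
    moreover have "g \<circ> s \<circ> inv g \<in> Hgrp k" by (intro Hgrp_closed g s)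
    ultimately show "\<exists>c\<in>Hgrp k. restr n c = id \<and>
        (\<forall>v. length v = n \<longrightarrow> v \<notin> {} \<longrightarrow> flips c v = (v = u))"
      by (auto simp: single_flip_def)
  qed (use Hgrp_closed Hgrp_Aut in auto)
  then obtain h where h: "h \<in> Hgrp k" "restr n h = id" "\<forall>w. length w = n \<longrightarrow> flips h w = flips t w"
    by auto
  then have "restr (Suc n) t = restr (Suc n) h"
    using assms Hgrp_Aut by (intro restr_Suc_eqI) auto
  then show ?thesis using h(1) by blast
qed

text \<open>The commutator \<open>[b\<^sub>2, g]\<close> flips exactly the pair \<open>w, g w\<close>, where \<open>w\<close> is the vertex flipped by
  \<open>b\<^sub>2\<close>.\<close>
lemma Dgrp_even_flips:
  assumes "t \<in> Aut" "restr (k + 2) t = id" "\<not> level_parity (k + 2) t"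
  shows "\<exists>d\<in>Dgrp k. restr (Suc (k + 2)) t = restr (Suc (k + 2)) d"
proof -
  let ?n = "k + 2"
  define w s where "w = True # replicate (Suc k) False" and "s = act k (B 2)"
  have s: "single_flip ?n w s" "s \<in> Hgrp k" "s \<in> Aut"
    using single_flip_B2 B_Hgrp [of 2 k] by (simp_all add: w_def s_def)
  have lw: "length w = ?n" using s(1) by (simp add: single_flip_def)
  \<comment> \<open>Each commutator used here also flips \<open>w\<close>. The label at
    \<open>w\<close> is therefore ignored first and recovered from the parity afterwards.\<close>
  have "\<exists>h\<in>Dgrp k. restr ?n h = id \<and> (\<forall>v. length v = ?n \<longrightarrow> v \<notin> {w} \<longrightarrow> flips h v = flips t v)"
  proof (rule flips_realised)
    fix u :: word assume u: "length u = ?n" "u \<notin> {w}"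
    then obtain g where g: "g \<in> Hgrp k" "g w = u"
      using lw Hgrp_transitive [of w u k] by auto
    have gA: "g \<in> Aut" by (rule Hgrp_Aut [OF g(1)])
    have c: "comm g s = (g \<circ> s \<circ> inv g) \<circ> s" by (simp add: comm_def s_def inv_act)
    have f: "single_flip ?n u (g \<circ> s \<circ> inv g)"
      using single_flip_conj [OF s(1) gA] g(2) by simp
    have "restr ?n (comm g s) = id"
      using f s(1,3) by (simp add: c restr_comp [of s] single_flip_def)
    moreover have "flips (comm g s) v = (v = u)" if "length v = ?n" "v \<notin> {w}" for v
    proof -
      have "s v = v" using s(1) that(1) by (simp add: single_flip_def restr_eq_id_iff)
      then have "flips (comm g s) v = (flips (g \<circ> s \<circ> inv g) v \<noteq> flips s v)"
        using s(3) gA by (simp add: c flips_comp [of "g \<circ> s \<circ> inv g" s])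
      then show ?thesis using f s(1) that by (simp add: single_flip_def)
    qed
    ultimately show "\<exists>c\<in>Dgrp k. restr ?n c = id \<and>
        (\<forall>v. length v = ?n \<longrightarrow> v \<notin> {w} \<longrightarrow> flips c v = (v = u))"
      using comm_Dgrp [OF g(1) s(2)] by blast
  qed (use Dgrp_closed Dgrp_Aut in auto)
  then obtain h where h: "h \<in> Dgrp k" "restr ?n h = id"
    "\<And>v. length v = ?n \<Longrightarrow> v \<noteq> w \<Longrightarrow> flips h v = flips t v" by auto
  have hA: "h \<in> Aut" by (rule Dgrp_Aut [OF h(1)])
  have "flips h w = flips t w"
    by (rule flips_eq_if_level_parity_eq [OF hA assms(1) _ lw h(3)]) (use level_parity_Dgrp [OF h(1)] assms(3) in auto)
  then have "flips t v = flips h v" if "length v = ?n" for v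
    using h(3) [OF that] by (cases "v = w") auto
  then have "restr (Suc ?n) t = restr (Suc ?n) h"
    using assms hA h(2) by (intro restr_Suc_eqI) auto
  then show ?thesis using h(1) by blast
qed

text \<open>Induction on \<open>m\<close>: the base is the even case at level \<open>k + 2\<close>,
  and \<open>Dgrp_pair\<close> puts the elements found for the two subtrees side by side.\<close>

lemma Dgrp_level:
  assumes "k \<ge> 1" "t \<in> Aut" "restr (m + (k + 2)) t = id"
    and "\<And>u. length u = m \<Longrightarrow> \<not> level_parity (k + 2) (sect t u)"
  shows "\<exists>d\<in>Dgrp k. restr (Suc (m + (k + 2))) t = restr (Suc (m + (k + 2))) d"
  using assms(2-)
proof (induction m arbitrary: t)
  case 0
  then show ?case using Dgrp_even_flips [of t k] by simp
next
  case (Suc m)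
  obtain e T where t: "t = wreath e T" "\<And>x. T x \<in> Aut" using Suc.prems(1) by (auto elim: Aut_cases)
  have st: "\<not> e" "\<And>x. restr (m + (k + 2)) (T x) = id"
    using Suc.prems(2) t(1) by (auto simp: restr_Suc_wreath_id)
  have "\<exists>d\<in>Dgrp k. restr (Suc (m + (k + 2))) (T x) = restr (Suc (m + (k + 2))) d" for x
    using Suc.prems(3) [of "x # _"] t st by (intro Suc.IH) auto
  then obtain D where D: "\<And>x. D x \<in> Dgrp k"
    "\<And>x. restr (Suc (m + (k + 2))) (T x) = restr (Suc (m + (k + 2))) (D x)" by metis
  have "wreath False D \<in> Dgrp k"
    unfolding wreath_False_eq_pair by (intro Dgrp_pair assms(1) D)
  moreover have "restr (Suc (Suc (m + (k + 2)))) t = restr (Suc (Suc (m + (k + 2)))) (wreath False D)"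
    using D(2) st(1) t(1) by (simp only: restr_Suc_wreath) simp
  ultimately show ?case by (metis add_Suc)
qed

subsection \<open>The pattern group and the closure\<close>

text \<open>Among the pairs \<open>(r\<^sub>k, b\<^sub>1)\<close>, \<open>(r\<^sub>k, b\<^sub>2)\<close>, \<open>(1, b\<^sub>0)\<close>, a section \<open>r\<^sub>k\<close> at one child goes with \<open>b\<^sub>1\<close> or \<open>b\<^sub>2\<close> at
  the other one, and \<open>a\<^sub>k\<^sub>+\<^sub>1 + a\<^sub>k\<^sub>+\<^sub>2\<close> is \<open>1\<close> on \<open>b\<^sub>1\<close> and \<open>b\<^sub>2\<close> but \<open>0\<close> on \<open>b\<^sub>0\<close>.\<close>
definition admissible :: "nat \<Rightarrow> tmap \<Rightarrow> bool" where
  "admissible k g \<longleftrightarrow> (\<forall>x. level_parity k (sect g [x]) = (level_parity (k + 1) (sect g [\<not> x]) \<noteq> level_parity (k + 2) (sect g [\<not> x])))"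

definition Kgrp :: "nat \<Rightarrow> tmap set" where
  "Kgrp k = {g \<in> Aut. \<forall>w. admissible k (sect g w)}"

lemma admissible_wreath: "admissible k (wreath e G) \<longleftrightarrow>
    (\<forall>x. level_parity k (G x) = (level_parity (k + 1) (G (\<not> x)) \<noteq> level_parity (k + 2) (G (\<not> x))))"
  unfolding admissible_def sect_wreath ..

lemma admissible_pair: "admissible k (pair g h) \<longleftrightarrow> level_parity k g = (level_parity (k + 1) h \<noteq> level_parity (k + 2) h) \<and>
    level_parity k h = (level_parity (k + 1) g \<noteq> level_parity (k + 2) g)"
  unfolding pair_def admissible_wreath all_bool_eq by auto

text \<open>The deepest labels involved are those of level \<open>k + 2\<close> in a child, that is
  level \<open>k + 3\<close> of \<open>g\<close>, visible on words of length
  \<open>k + 4\<close>.\<close>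

lemma admissible_restr_cong:
  assumes "restr (k + 4) g = restr (k + 4) h" shows "admissible k g = admissible k h"
proof -
  have "restr (k + 3) (sect g [x]) = restr (k + 3) (sect h [x])" for x
    using assms sect_restr [of "k + 3" g x] sect_restr [of "k + 3" h x] by (simp add: eval_nat_numeral)
  then have "level_parity j (sect g [x]) = level_parity j (sect h [x])" if "j < k + 3" for j x
    using level_parity_restr_cong that by blast
  then show ?thesis by (simp add: admissible_def del: level_parity.simps)
qed

lemma admissible_id: "admissible k id"
  using admissible_pair [of k id id] by simp

lemma admissible_comp:
  assumes "g \<in> Aut" "h \<in> Aut" "admissible k g" "admissible k h" shows "admissible k (g \<circ> h)"
proof -
  obtain e G where g: "g = wreath e G" "\<And>x. G x \<in> Aut" using assms(1) by (auto elim: Aut_cases)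
  obtain f F where h: "h = wreath f F" "\<And>x. F x \<in> Aut" using assms(2) by (auto elim: Aut_cases)
  have "level_parity k (G (x \<noteq> f) \<circ> F x) = (level_parity (k + 1) (G ((\<not> x) \<noteq> f) \<circ> F (\<not> x)) \<noteq>
      level_parity (k + 2) (G ((\<not> x) \<noteq> f) \<circ> F (\<not> x)))" for x
  proof -
    \<comment> \<open>The root flip of \<open>h\<close> sends opposite children to opposite
      children, so the condition for \<open>h\<close> at \<open>x\<close> is added to that for
      \<open>g\<close> at \<open>x \<noteq> f\<close>.\<close>
    have "((\<not> x) \<noteq> f) = (\<not> (x \<noteq> f))" by auto
    then show ?thesis
      using assms(3) [unfolded g(1) admissible_wreath, rule_format, of "x \<noteq> f"]
        assms(4) [unfolded h(1) admissible_wreath, rule_format, of x]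
      unfolding level_parity_comp [OF g(2) h(2)] by argo
  qed
  then show ?thesis unfolding g(1) h(1) wreath_comp admissible_wreath by blast
qed

lemma admissible_inv:
  assumes "g \<in> Aut" "admissible k g" shows "admissible k (inv g)"
proof -
  obtain e G where g: "g = wreath e G" "\<And>x. G x \<in> Aut" using assms(1) by (auto elim: Aut_cases)
  have "level_parity k (inv (G (x \<noteq> e))) = (level_parity (k + 1) (inv (G ((\<not> x) \<noteq> e))) \<noteq>
      level_parity (k + 2) (inv (G ((\<not> x) \<noteq> e))))" for x
  proof -
    have "((\<not> x) \<noteq> e) = (\<not> (x \<noteq> e))" by auto
    then show ?thesis
      using assms(2) [unfolded g(1) admissible_wreath, rule_format, of "x \<noteq> e"]
      unfolding level_parity_inv [OF g(2)] by argo
  qed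
  then show ?thesis unfolding g(1) inv_wreath [OF g(2)] admissible_wreath by blast
qed

lemma sect_id [simp]: "sect id w = id"
  by (simp add: sect_def id_def)

lemma sect_inv:
  assumes "g \<in> Aut" shows "sect (inv g) w = inv (sect g (inv g w))"
proof -
  let ?a = "sect g (inv g w)" and ?b = "sect (inv g) w"
  have "?a \<circ> ?b = id" using sect_comp [of g "inv g" w] assms by simp
  then have "inv ?a \<circ> (?a \<circ> ?b) = inv ?a" by simp
  then show ?thesis using assms by simp
qed

lemma Kgrp_subgroup: "is_subgroup_of (Kgrp k) Aut"
  by (auto simp: is_subgroup_of_def Kgrp_def admissible_id sect_comp admissible_comp sect_inv admissible_inv)

lemma Kgrp_Aut: "g \<in> Kgrp k \<Longrightarrow> g \<in> Aut"
  by (simp add: Kgrp_def)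

lemma Kgrp_wreath: "wreath e G \<in> Kgrp k \<longleftrightarrow> admissible k (wreath e G) \<and> (\<forall>x. G x \<in> Kgrp k)"
proof -
  have "(\<forall>w. admissible k (sect (wreath e G) w)) \<longleftrightarrow> admissible k (wreath e G) \<and> (\<forall>x w. admissible k (sect (G x) w))"
  proof
    assume h: "\<forall>w. admissible k (sect (wreath e G) w)"
    show "admissible k (wreath e G) \<and> (\<forall>x w. admissible k (sect (G x) w))"
      using h [rule_format, of "[]"] h [rule_format, of "_ # _"] by simp
  next
    assume h: "admissible k (wreath e G) \<and> (\<forall>x w. admissible k (sect (G x) w))"
    show "\<forall>w. admissible k (sect (wreath e G) w)"
    proof
      fix w show "admissible k (sect (wreath e G) w)" using h by (cases w) auto
    qed
  qed
  then show ?thesis by (auto simp: Kgrp_def)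
qed

lemma level_parity_pair: "level_parity (Suc j) (pair g h) = (level_parity j g \<noteq> level_parity j h)"
  by (simp add: pair_def)

lemma level_parity_R: "level_parity j (act k (R i)) = (j = i)"
proof (induction j arbitrary: i)
  case 0
  then show ?case by (cases i) (auto simp: id_def)
next
  case (Suc j)
  show ?case
  proof (cases i)
    case 0
    then show ?thesis by (simp add: act_R_0)
  next
    case (Suc i)
    then show ?thesis using Suc.IH by (simp only: act_R_Suc level_parity_pair level_parity_id) simp
  qed
qed

lemma level_parity_B_low: "j \<le> k \<Longrightarrow> \<not> level_parity j (act k (B i))"
  using level_parity_fixed [OF B_stab, of "Suc k" k j] by simp

lemma level_parity_B:
  "level_parity (k + 1) (act k (B 0))" "level_parity (k + 2) (act k (B 0))"
  "level_parity (k + 1) (act k (B 1))" "\<not> level_parity (k + 2) (act k (B 1))"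
  "\<not> level_parity (k + 1) (act k (B 2))" "level_parity (k + 2) (act k (B 2))"
proof -
  have s: "k + 1 = Suc k" "k + 2 = Suc (Suc k)" by simp_all
  show l0: "level_parity (k + 1) (act k (B 0))"
    unfolding act_B(1) s level_parity_pair by (simp add: level_parity_R level_parity_B_low del: level_parity.simps)
  show l1: "level_parity (k + 1) (act k (B 1))"
    unfolding act_B(2) s level_parity_pair by (simp add: level_parity_R level_parity_B_low del: level_parity.simps)
  show l2: "\<not> level_parity (k + 1) (act k (B 2))"
    unfolding act_B(3) s level_parity_pair by (simp add: level_parity_B_low del: level_parity.simps)
  \<comment> \<open>Parities at level \<open>k + 2\<close> reduce to level \<open>k + 1\<close> of
    the next \<open>B\<close> in the cycle, so all three of the latter come first.\<close>
  note l = l0 l1 l2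
  show "level_parity (k + 2) (act k (B 0))"
    unfolding act_B(1) s level_parity_pair using l by (simp add: level_parity_R del: level_parity.simps)
  show "\<not> level_parity (k + 2) (act k (B 1))"
    unfolding act_B(2) s level_parity_pair using l by (simp add: level_parity_R del: level_parity.simps)
  show "level_parity (k + 2) (act k (B 2))"
    unfolding act_B(3) s level_parity_pair using l by (simp del: level_parity.simps)
qed

lemma admissible_R: "i \<le> k \<Longrightarrow> admissible k (act k (R i))"
proof (cases i)
  case 0
  then show ?thesis by (simp add: act_R_0 admissible_wreath del: level_parity.simps)
next
  case (Suc j)
  assume "i \<le> k"
  then show ?thesis using Suc by (simp add: act_R_Suc admissible_pair level_parity_R del: level_parity.simps)
qed

lemma admissible_B: "admissible k (act k (B 0))" "admissible k (act k (B 1))" "admissible k (act k (B 2))"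
proof -
  show "admissible k (act k (B 0))" unfolding act_B(1) admissible_pair using level_parity_B [of k] level_parity_B_low [of k k] by (simp add: level_parity_R del: level_parity.simps)
  show "admissible k (act k (B 1))" unfolding act_B(2) admissible_pair using level_parity_B [of k] level_parity_B_low [of k k] by (simp add: level_parity_R del: level_parity.simps)
  show "admissible k (act k (B 2))" unfolding act_B(3) admissible_pair using level_parity_B [of k] level_parity_B_low [of k k] by (simp add: level_parity_R del: level_parity.simps)
qed

text \<open>The generators together with the identity form a set \<open>V\<close> closed under
  sections, so admissibility has to be checked only on \<open>V\<close>.\<close>

lemma gens_Kgrp: "gens k \<subseteq> Kgrp k"
proof -
  define V where "V = insert id (gens k)"
  have admissible: "admissible k s" if "s \<in> V" for s
  proof (cases "s = id")
    case False
    then have "s \<in> gens k" using that by (simp add: V_def)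
    then show ?thesis by (cases rule: gens_cases) (simp_all add: admissible_R admissible_B [simplified])
  qed (simp add: admissible_id)
  have R: "act k (R i) \<in> V" if "i \<le> k" for i using that by (auto simp: V_def gens_def)
  have B: "act k (B j) \<in> V" if "j < 3" for j using that by (auto simp: V_def gens_def)
  have prV: "sect (pair g h) [x] \<in> V" if "g \<in> V" "h \<in> V" for g h x
    using that by (simp add: pair_def)
  have idV: "id \<in> V" by (simp add: V_def)
  have sectR: "sect (act k (R i)) [x] \<in> V" if "i \<le> k" for i x
  proof (cases i)
    case 0
    then show ?thesis using idV by (simp add: act_R_0)
  next
    case (Suc j)
    then show ?thesis using that unfolding Suc act_R_Suc by (intro prV R idV) simp
  qed
  have sect: "sect s [x] \<in> V" if "s \<in> V" for s x
  proof (cases "s = id")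
    case False
    then have "s \<in> gens k" using that by (simp add: V_def)
    then show ?thesis
    proof (cases rule: gens_cases)
      case (1 i)
      then show ?thesis using sectR [of i] by simp
    next
      case 2
      then show ?thesis using sectR [of k] by simp
    next
      case 3
      show ?thesis unfolding 3 act_B(1) by (intro prV R B) auto
    next
      case 4
      show ?thesis unfolding 4 act_B(2) by (intro prV R B) auto
    next
      case 5
      show ?thesis unfolding 5 act_B(3) by (intro prV B idV) auto
    qed
  qed (simp add: idV)
  have "sect s w \<in> V" if "s \<in> V" for s w
    using that
  proof (induction w arbitrary: s)
    case (Cons x w)
    then show ?case using sect sect_Cons [of s x w] by simp
  qed simp
  then show ?thesis using admissible gens_Aut [of k] by (auto simp: Kgrp_def V_def)
qed

lemma Hgrp_Kgrp: "g \<in> Hgrp k \<Longrightarrow> g \<in> Kgrp k"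
  unfolding Hgrp_def by (rule gen_subgroup_least [OF Kgrp_subgroup gens_Kgrp])

section \<open>Density and closure\<close>

text \<open>Dividing by an approximation \<open>h\<close> at level \<open>n\<close> reduces the next
  level to elements that fix level \<open>n\<close>.\<close>

lemma density_step:
  assumes "g \<in> Aut" "h \<in> Hgrp k" "restr n g = restr n h"
    and "restr n (inv h \<circ> g) = id \<Longrightarrow> \<exists>f\<in>Hgrp k. restr (Suc n) (inv h \<circ> g) = restr (Suc n) f"
  shows "\<exists>f\<in>Hgrp k. restr (Suc n) g = restr (Suc n) f"
proof -
  have h: "h \<in> Aut" by (rule Hgrp_Aut [OF assms(2)])
  have "restr n (inv h \<circ> g) = restr n (inv h \<circ> h)"
    using assms(1,3) h by (simp only: restr_comp)
  then have "restr n (inv h \<circ> g) = id" using h by simp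
  then obtain f where f: "f \<in> Hgrp k" "restr (Suc n) (inv h \<circ> g) = restr (Suc n) f"
    using assms(4) by blast
  have "restr (Suc n) (h \<circ> (inv h \<circ> g)) = restr (Suc n) (h \<circ> f)"
    using f h assms(1) Hgrp_Aut [OF f(1)] by (intro restr_comp_cong) auto
  then show ?thesis using h Hgrp_closed(2) [OF assms(2) f(1)] by auto
qed

lemma Hgrp_dense_Aut:
  assumes "g \<in> Aut" "n \<le> k + 3" shows "\<exists>h\<in>Hgrp k. restr n g = restr n h"
  using assms(2)
proof (induction n)
  case 0
  show ?case using Hgrp_closed(1) [of k] assms(1) by (intro bexI [of _ id]) simp_all
next
  case (Suc n)
  then obtain h where h: "h \<in> Hgrp k" "restr n g = restr n h" by auto
  show ?case
    by (rule density_step [OF assms(1) h])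
      (use Suc.prems assms(1) Hgrp_Aut [OF h(1)] in \<open>auto intro!: Hgrp_level_full\<close>)
qed

lemma restr_sect_id: "restr (m + n) t = id \<Longrightarrow> length u = m \<Longrightarrow> restr n (sect t u) = id"
  by (simp add: restr_eq_id_iff sect_def)

lemma Hgrp_dense_Kgrp:
  assumes k: "k \<ge> 1" and g: "g \<in> Kgrp k" shows "\<exists>h\<in>Hgrp k. restr n g = restr n h"
proof (induction n)
  case 0
  show ?case using Hgrp_closed(1) [of k] Kgrp_Aut [OF g] by (intro bexI [of _ id]) simp_all
next
  case (Suc n)
  then obtain h where h: "h \<in> Hgrp k" "restr n g = restr n h" by auto
  define t where "t = inv h \<circ> g"
  have t: "t \<in> Kgrp k"
    using Kgrp_subgroup [of k] Hgrp_Kgrp [OF Hgrp_closed(3) [OF h(1)]] g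
    by (simp add: t_def is_subgroup_of_def)
  have tA: "t \<in> Aut" by (rule Kgrp_Aut [OF t])
  have "\<exists>f\<in>Hgrp k. restr (Suc n) t = restr (Suc n) f" if fix_n: "restr n t = id"
  proof (cases "n \<le> k + 2")
    case True
    then show ?thesis using tA fix_n by (rule Hgrp_level_full)
  next
    case False
    \<comment> \<open>Beyond level \<open>k + 2\<close>, a root \<open>u\<close> of a subtree of
      depth \<open>k + 2\<close> has a parent \<open>v\<close>. Admissibility at \<open>v\<close>,
      read at the sibling of \<open>u\<close>, leaves only the parity at level \<open>k + 2\<close>
      below \<open>u\<close>, since the other two vanish.\<close>
    then obtain m where m: "n = Suc m + (k + 2)"
      by (metis add.commute add_Suc_right le_Suc_ex not_less_eq_eq)
    have "\<not> level_parity (k + 2) (sect t u)" if u: "length u = Suc m" for u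
    proof -
      obtain v x where v: "u = v @ [x]" "length v = m" using u by (cases u rule: rev_cases) auto
      have "restr (k + 2) (sect t u) = id" if "length u = Suc m" for u
        using restr_sect_id fix_n that unfolding m by blast
      then have "\<not> level_parity j (sect t (v @ [y]))" if "j < k + 2" for j y
        using that v(2) by (intro level_parity_fixed [of "k + 2"]) auto
      then have low: "\<not> level_parity k (sect t (v @ [\<not> x]))" "\<not> level_parity (k + 1) (sect t (v @ [x]))"
        by (simp_all del: level_parity.simps)
      have "admissible k (sect t v)" using t by (simp add: Kgrp_def)
      then have "level_parity k (sect (sect t v) [\<not> x]) =
          (level_parity (k + 1) (sect (sect t v) [\<not> \<not> x]) \<noteq> level_parity (k + 2) (sect (sect t v) [\<not> \<not> x]))"
        unfolding admissible_def by blast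
      then show ?thesis using low v(1) by (simp only: sect_append not_not) argo
    qed
    then show ?thesis using Dgrp_level [OF k tA fix_n [unfolded m]] Dgrp_Hgrp unfolding m by blast
  qed
  then show ?case using density_step [OF Kgrp_Aut [OF g] h] unfolding t_def by blast
qed

text \<open>\<open>K\<close> is closed: each of its conditions concerns only finitely many
  levels.\<close>

lemma Kgrp_if_dense:
  assumes "g \<in> Aut" "\<And>n. \<exists>h\<in>Kgrp k. restr n g = restr n h" shows "g \<in> Kgrp k"
proof -
  have "admissible k (sect g w)" for w
  proof -
    obtain h where h: "h \<in> Kgrp k" "restr (length w + (k + 4)) g = restr (length w + (k + 4)) h"
      using assms(2) by blast
    have "restr (k + 4) (sect g w) = restr (k + 4) (sect h w)"
      using h(2) by (simp add: restr_eq_iff sect_def)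
    from admissible_restr_cong [OF this] show ?thesis using h(1) by (simp add: Kgrp_def)
  qed
  then show ?thesis using assms(1) by (simp add: Kgrp_def)
qed

lemma tclosure_Hgrp: assumes "k \<ge> 1" shows "tclosure (Hgrp k) = Kgrp k"
proof
  show "Kgrp k \<subseteq> tclosure (Hgrp k)"
    using Hgrp_dense_Kgrp [OF assms] Kgrp_Aut by (auto simp: tclosure_def)
  show "tclosure (Hgrp k) \<subseteq> Kgrp k"
  proof
    fix g assume "g \<in> tclosure (Hgrp k)"
    then have g: "g \<in> Aut" "\<And>n. \<exists>h\<in>Hgrp k. restr n g = restr n h" by (simp_all add: tclosure_def)
    show "g \<in> Kgrp k" using g(2) Hgrp_Kgrp by (intro Kgrp_if_dense g(1)) blast
  qed
qed

section \<open>Patterns of size k + 4\<close>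

definition Pgrp :: "nat \<Rightarrow> tmap set" where
  "Pgrp k = restr (k + 4) ` {g \<in> Aut. admissible k g}"

lemma restr_Pgrp_iff:
  assumes "g \<in> Aut" shows "restr (k + 4) g \<in> Pgrp k \<longleftrightarrow> admissible k g"
proof
  assume "restr (k + 4) g \<in> Pgrp k"
  then obtain h where "restr (k + 4) g = restr (k + 4) h" "admissible k h" by (auto simp: Pgrp_def)
  then show "admissible k g" using admissible_restr_cong by blast
qed (use assms in \<open>simp add: Pgrp_def\<close>)

lemma Kgrp_eq_G_P: "Kgrp k = G_P (k + 4) (Pgrp k)"
  by (auto simp: Kgrp_def G_P_def restr_Pgrp_iff)

text \<open>The two conditions defining \<^const>\<open>admissible\<close> involve level \<open>k + 3\<close> through independent parities, so
  they can be met by changing flips of that level only.\<close>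
lemma admissible_correction:
  assumes "s \<in> Aut" shows "\<exists>q\<in>Aut. admissible k q \<and> restr (k + 3) q = restr (k + 3) s"
proof -
  \<comment> \<open>\<open>R (k + 2)\<close> changes, among the three parities involved, only the
    one at level \<open>k + 2\<close>. Inserting it at \<open>x\<close> repairs the condition with
    \<open>x\<close> on the right and leaves the other one alone.\<close>
  define c where "c x = (if level_parity k (sect s [\<not> x]) = (level_parity (k + 1) (sect s [x]) \<noteq> level_parity (k + 2) (sect s [x]))
    then id else act k (R (k + 2)))" for x
  have cA: "c x \<in> Aut" for x by (simp add: c_def)
  have low: "\<not> level_parity j (c x)" if "j < k + 2" for j x
    using that by (simp add: c_def level_parity_R del: level_parity.simps)
  have c2: "level_parity (k + 2) (c x) \<longleftrightarrow>
      level_parity k (sect s [\<not> x]) \<noteq> (level_parity (k + 1) (sect s [x]) \<noteq> level_parity (k + 2) (sect s [x]))" for x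
    by (simp add: c_def level_parity_R del: level_parity.simps)
  obtain e S where s: "s = wreath e S" "\<And>x. S x \<in> Aut" using assms by (auto elim: Aut_cases)
  have "level_parity k (S x \<circ> c x) = (level_parity (k + 1) (S (\<not> x) \<circ> c (\<not> x)) \<noteq> level_parity (k + 2) (S (\<not> x) \<circ> c (\<not> x)))" for x
    using low [of k x] low [of "k + 1" "\<not> x"] c2 [of "\<not> x"]
    unfolding level_parity_comp [OF s(2) cA] s(1) sect_wreath by (simp del: level_parity.simps) argo
  then have "admissible k (s \<circ> wreath False c)" unfolding s(1) wreath_comp admissible_wreath by simp
  moreover have "restr (Suc (k + 2)) (wreath False c) = id"
    unfolding restr_Suc_wreath_id using R_stab [of "k + 2" k] by (simp add: c_def)
  then have "restr (k + 3) (s \<circ> wreath False c) = restr (k + 3) s"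
    using cA by (simp add: restr_comp eval_nat_numeral)
  ultimately show ?thesis using assms cA by (intro bexI [of _ "s \<circ> wreath False c"]) simp_all
qed

lemma Pgrp_essential: "essential_pattern_group (k + 4) (Pgrp k)"
proof -
  have "p \<circ> q \<in> Pgrp k" if "p \<in> Pgrp k" "q \<in> Pgrp k" for p q
    using that by (auto simp: Pgrp_def admissible_comp simp flip: restr_comp)
  moreover have "inv p \<in> Pgrp k" if "p \<in> Pgrp k" for p
    using that by (auto simp: Pgrp_def admissible_inv simp flip: restr_inv)
  moreover have "id \<in> Pgrp k"
    using restr_Pgrp_iff [of id k] by (simp add: admissible_id)
  moreover have "\<exists>q\<in>Pgrp k. restr (k + 4 - 1) q = sect p [i]" if p: "p \<in> Pgrp k" for p i
  proof -
    obtain g where g: "g \<in> Aut" "p = restr (Suc (k + 3)) g"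
      using p by (auto simp: Pgrp_def eval_nat_numeral)
    \<comment> \<open>The section of a pattern is known only down to level \<open>k + 3\<close>, so
      it may be extended admissibly.\<close>
    obtain q where q: "q \<in> Aut" "admissible k q" "restr (k + 3) q = restr (k + 3) (sect g [i])"
      using admissible_correction [OF sect_Aut [OF g(1)]] by blast
    have "restr (k + 3) (restr (k + 4) q) = sect p [i]"
      unfolding g(2) sect_restr q(3) [symmetric] by (auto simp: restr_def fun_eq_iff)
    moreover have "restr (k + 4) q \<in> Pgrp k" using q by (simp add: Pgrp_def)
    moreover have "k + 4 - 1 = k + 3" by simp
    ultimately show ?thesis by metis
  qed
  ultimately show ?thesis
    by (auto simp: essential_pattern_group_def is_subgroup_of_def Pgrp_def Gfin_def)
qed

text \<open>In \<open>(act k (R (k + 2)), id)\<close> exactly one of the six parities is odd, which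
  violates one condition.\<close>

lemma R_not_Kgrp: "act k (R (k + 3)) \<notin> Kgrp k"
proof -
  have "act k (R (k + 3)) = pair (act k (R (k + 2))) id"
    using act_R_Suc [of k "k + 2"] by (simp add: eval_nat_numeral)
  then have "\<not> admissible k (act k (R (k + 3)))" by (simp add: admissible_pair level_parity_R del: level_parity.simps)
  then have "\<not> admissible k (sect (act k (R (k + 3))) [])" by simp
  then show ?thesis unfolding Kgrp_def by blast
qed

text \<open>With \<open>d \<le> k + 3\<close> every pattern of size \<open>d\<close> is realised in
  \<open>H\<close>, so \<open>P\<close> contains all of them and \<open>G_P d P\<close> is the full
  group, contrary to \<open>R_not_Kgrp\<close>.\<close>

lemma Kgrp_pattern_size:
  assumes "constrained_by_size (Kgrp k) d" shows "k + 4 \<le> d"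
proof (rule ccontr)
  assume d: "\<not> k + 4 \<le> d"
  obtain P where P: "Kgrp k = G_P d P" using assms by (auto simp: constrained_by_size_def)
  have "restr d g \<in> P" if gA: "g \<in> Aut" for g
  proof -
    obtain h where h: "h \<in> Hgrp k" "restr d g = restr d h"
      using Hgrp_dense_Aut [OF gA, of d k] d by auto
    have "h \<in> G_P d P" using Hgrp_Kgrp [OF h(1)] P by simp
    then have "\<forall>w. restr d (sect h w) \<in> P" by (simp add: G_P_def)
    from this [rule_format, of "[]"] show ?thesis using h(2) by simp
  qed
  then have "act k (R (k + 3)) \<in> G_P d P" by (simp add: G_P_def)
  then show False using P R_not_Kgrp [of k] by simp
qed

subsection \<open>Hausdorff dimension\<close>

lemma restr_restr [simp]: "restr n (restr n g) = restr n g"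
  by (auto simp: restr_def)

text \<open>An element one level deeper is a root flip and a pair of restricted sections. The
  relation \<open>Q\<close> of allowed pairs serves both the full group and
  \<open>K\<close>.\<close>

lemma restr_Suc_image:
  "restr (Suc n) ` {wreath e (\<lambda>x. if x then h else g) | e g h. (g, h) \<in> Q} =
    (\<lambda>(e, p, q). restr (Suc n) (wreath e (\<lambda>x. if x then q else p))) `
      (UNIV \<times> map_prod (restr n) (restr n) ` Q)" (is "?A = ?F ` ?C")
proof -
  have *: "restr (Suc n) (wreath e (\<lambda>x. if x then h else g)) =
      restr (Suc n) (wreath e (\<lambda>x. if x then restr n h else restr n g))" for e g h
    by (simp add: restr_Suc_wreath)
  show ?thesis
  proof
    show "?A \<subseteq> ?F ` ?C"
    proof
      fix y assume "y \<in> ?A"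
      then obtain e g h where "(g, h) \<in> Q" "y = restr (Suc n) (wreath e (\<lambda>x. if x then h else g))" by blast
      then show "y \<in> ?F ` ?C"
        by (intro image_eqI [of _ _ "(e, restr n g, restr n h)"]) (auto simp: * [of e h g])
    qed
    show "?F ` ?C \<subseteq> ?A" unfolding image_subset_iff by (auto simp flip: *) blast
  qed
qed

lemma card_restr_Suc:
  "card (restr (Suc n) ` {wreath e (\<lambda>x. if x then h else g) | e g h. (g, h) \<in> Q}) =
    2 * card (map_prod (restr n) (restr n) ` Q)"
proof -
  have "inj_on (\<lambda>(e, p, q). restr (Suc n) (wreath e (\<lambda>x. if x then q else p)))
      (UNIV \<times> map_prod (restr n) (restr n) ` Q)"
  proof (rule inj_onI, clarsimp)
    fix e g h e' g' h'
    assume "restr (Suc n) (wreath e (\<lambda>x. if x then restr n h else restr n g)) =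
        restr (Suc n) (wreath e' (\<lambda>x. if x then restr n h' else restr n g'))"
    then show "e = e' \<and> restr n g = restr n g' \<and> restr n h = restr n h'"
      by (simp add: restr_Suc_wreath all_bool_eq)
  qed
  then show ?thesis
    unfolding restr_Suc_image by (simp add: card_image card_cartesian_product UNIV_bool)
qed

lemma Aut_eq_wreath_pairs: "Aut = {wreath e (\<lambda>x. if x then h else g) | e g h. (g, h) \<in> Aut \<times> Aut}"
proof -
  have "\<exists>e h k. g = wreath e (\<lambda>x. if x then k else h) \<and> h \<in> Aut \<and> k \<in> Aut" if "g \<in> Aut" for g
  proof -
    obtain e G where "g = wreath e G" "\<And>x. G x \<in> Aut" using \<open>g \<in> Aut\<close> by (auto elim: Aut_cases)
    then show ?thesis
      by (intro exI [of _ e] exI [of _ "G False"] exI [of _ "G True"]) (auto intro!: ext)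
  qed
  then show ?thesis by (auto simp: all_bool_eq)
qed

lemma finite_restr_Aut: "finite (restr n ` Aut)"
proof (induction n)
  case 0
  have "restr 0 ` Aut \<subseteq> {id}" by auto
  then show ?case by (rule finite_subset) simp
next
  case (Suc n)
  then show ?case
    by (subst Aut_eq_wreath_pairs, subst restr_Suc_image) (simp add: map_prod_surj_on)
qed

lemma card_restr_Aut_Suc: "card (restr (Suc n) ` Aut) = 2 * (card (restr n ` Aut))\<^sup>2"
proof -
  have "map_prod (restr n) (restr n) ` (Aut \<times> Aut) = restr n ` Aut \<times> restr n ` Aut" by force
  then show ?thesis
    by (subst Aut_eq_wreath_pairs, subst card_restr_Suc) (simp add: card_cartesian_product power2_eq_square)
qed

lemma log_card_restr_Aut: "log 2 (real (card (restr n ` Aut))) = 2 ^ n - 1"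
proof (induction n)
  case 0
  have "restr 0 ` Aut = (\<lambda>g. id) ` Aut" by (rule image_cong) simp_all
  then have "restr 0 ` Aut = {id}" by (simp only: image_constant [OF Aut_id])
  then show ?case by simp
next
  case (Suc n)
  have "Aut \<noteq> {}" using Aut_id by blast
  then have "card (restr n ` Aut) > 0" by (simp add: card_gt_0_iff finite_restr_Aut)
  then have "log 2 (real (card (restr (Suc n) ` Aut))) = 1 + 2 * log 2 (real (card (restr n ` Aut)))"
    by (simp add: card_restr_Aut_Suc log_mult log_nat_power)
  then show ?case using Suc by simp
qed

lemma finite_restr_Kgrp: "finite (restr n ` Kgrp k)"
  by (rule finite_subset [OF image_mono finite_restr_Aut]) (auto simp: Kgrp_def)

text \<open>The two sides of the admissibility condition: \<open>(g, h)\<close> is admissible when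
  the parities of \<open>h\<close> are those of \<open>g\<close> interchanged.\<close>

definition parities :: "nat \<Rightarrow> tmap \<Rightarrow> bool \<times> bool" where
  "parities k g = (level_parity k g, level_parity (k + 1) g \<noteq> level_parity (k + 2) g)"

lemma parities_restr: "n \<ge> k + 3 \<Longrightarrow> parities k (restr n g) = parities k g"
proof -
  assume "n \<ge> k + 3"
  then have "level_parity j (restr n g) = level_parity j g" if "j < k + 3" for j
    using that by (intro level_parity_restr_cong [of n]) auto
  then show ?thesis by (simp add: parities_def del: level_parity.simps)
qed

text \<open>\<open>R k\<close> and \<open>B 1\<close> realise the two basis vectors of the
  target.\<close>

lemma Kgrp_parities_surj: "\<exists>s\<in>Kgrp k. parities k s = a"
proof -
  have r: "act k (R k) \<in> Kgrp k" "parities k (act k (R k)) = (True, False)"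
    using Hgrp_Kgrp [OF R_Hgrp] by (simp_all add: parities_def level_parity_R del: level_parity.simps)
  have b: "act k (B 1) \<in> Kgrp k" "parities k (act k (B 1)) = (False, True)"
    using Hgrp_Kgrp [OF B_Hgrp] level_parity_B(3,4) [of k] level_parity_B_low [of k k]
    by (simp_all add: parities_def del: level_parity.simps)
  have i: "id \<in> Kgrp k" "parities k id = (False, False)"
    using Hgrp_Kgrp [OF Hgrp_closed(1)] by (simp_all add: parities_def del: level_parity.simps)
  have rb: "act k (R k) \<circ> act k (B 1) \<in> Kgrp k"
    using Kgrp_subgroup [of k] r(1) b(1) by (simp only: is_subgroup_of_def)
  have rb2: "parities k (act k (R k) \<circ> act k (B 1)) = (True, True)"
    using r(2) b(2) unfolding parities_def level_parity_comp [OF act_Aut act_Aut] by (simp del: level_parity.simps)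
  consider "a = (True, False)" | "a = (False, True)" | "a = (False, False)" | "a = (True, True)"
    by (cases a) auto
  then show ?thesis
  proof cases
    case 1 show ?thesis by (rule bexI [OF _ r(1)]) (use r(2) 1 in simp)
  next
    case 2 show ?thesis by (rule bexI [OF _ b(1)]) (use b(2) 2 in simp)
  next
    case 3 show ?thesis by (rule bexI [OF _ i(1)]) (use i(2) 3 in simp)
  next
    case 4 show ?thesis by (rule bexI [OF _ rb]) (use rb2 4 in simp)
  qed
qed

text \<open>Parities are a surjective homomorphism from \<open>K\<close> onto a group of order four,
  so left translations identify the four fibres.\<close>

lemma card_parities_fibre:
  assumes n: "n \<ge> k + 3"
  shows "4 * card {p \<in> restr n ` Kgrp k. parities k p = a} = card (restr n ` Kgrp k)"
proof -
  let ?C = "restr n ` Kgrp k"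
  let ?F = "\<lambda>a. {p \<in> ?C. parities k p = a}"
  have fin: "finite (?F a)" for a using finite_restr_Kgrp by simp
  have le: "card (?F a) \<le> card (?F b)" for a b
  proof -
    \<comment> \<open>The translating element realises the difference of \<open>a\<close> and
      \<open>b\<close>; injectivity gives one inequality, and exchanging \<open>a\<close> and
      \<open>b\<close> the other.\<close>
    obtain s where s: "s \<in> Kgrp k" "parities k s = (fst a \<noteq> fst b, snd a \<noteq> snd b)"
      using Kgrp_parities_surj by blast
    have sA: "s \<in> Aut" by (rule Kgrp_Aut [OF s(1)])
    show ?thesis
    proof (rule card_inj_on_le [OF _ _ fin])
      have "inv (restr n s) \<circ> restr n s = id"
        using sA by (simp flip: restr_inv restr_comp)
      then have "p = q" if "restr n s \<circ> p = restr n s \<circ> q" for p q :: tmap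
        using arg_cong [OF that, of "\<lambda>f. inv (restr n s) \<circ> f"] by (simp flip: comp_assoc)
      then show "inj_on (\<lambda>p. restr n s \<circ> p) (?F a)" by (rule inj_onI)
      show "(\<lambda>p. restr n s \<circ> p) ` ?F a \<subseteq> ?F b"
      proof safe
        fix g assume g: "g \<in> Kgrp k" and a: "a = parities k (restr n g)"
        have gA: "g \<in> Aut" by (rule Kgrp_Aut [OF g])
        have eq: "restr n s \<circ> restr n g = restr n (s \<circ> g)" using gA by (simp add: restr_comp)
        have "s \<circ> g \<in> Kgrp k" using Kgrp_subgroup [of k] s(1) g by (simp add: is_subgroup_of_def)
        then show "restr n s \<circ> restr n g \<in> ?C" unfolding eq by blast
        have pg: "parities k g = a" using a parities_restr [OF n] by simp
        have "parities k (s \<circ> g) = (fst (parities k s) \<noteq> fst a, snd (parities k s) \<noteq> snd a)"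
          unfolding pg [symmetric] parities_def level_parity_comp [OF sA gA] by (auto simp del: level_parity.simps)
        also have "\<dots> = b" unfolding s(2) by (cases a; cases b) auto
        finally show "parities k (restr n s \<circ> restr n g) = b"
          unfolding eq parities_restr [OF n] .
      qed
    qed
  qed
  then have eq: "card (?F b) = card (?F a)" for b by (simp add: le_antisym)
  have "card ?C = (\<Sum>b\<in>UNIV. \<Sum>p | p \<in> ?C \<and> parities k p = b. 1)"
    by (subst sum.group) (auto simp: finite_restr_Kgrp id_apply)
  also have "\<dots> = (\<Sum>b\<in>(UNIV :: (bool \<times> bool) set). card (?F a))"
    by (rule sum.cong [OF refl], subst card_eq_sum [symmetric], rule eq)
  also have "\<dots> = 4 * card (?F a)"
    by (simp add: id_apply card_cartesian_product flip: UNIV_Times_UNIV)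
  finally show ?thesis ..
qed

lemma admissible_wreath_parities: "admissible k (wreath e (\<lambda>x. if x then h else g)) \<longleftrightarrow> parities k h = prod.swap (parities k g)"
  unfolding admissible_wreath all_bool_eq by (auto simp: parities_def simp del: level_parity.simps)

lemma Kgrp_eq_wreath_pairs: "Kgrp k = {wreath e (\<lambda>x. if x then h else g) | e g h.
    (g, h) \<in> {(g, h). g \<in> Kgrp k \<and> h \<in> Kgrp k \<and> parities k h = prod.swap (parities k g)}}" (is "_ = ?R")
proof
  show "Kgrp k \<subseteq> ?R"
  proof
    fix g assume g: "g \<in> Kgrp k"
    obtain e G where "g = wreath e G" using Kgrp_Aut [OF g] by (auto elim: Aut_cases)
    moreover have "G = (\<lambda>x. if x then G True else G False)" by auto
    ultimately have eq: "g = wreath e (\<lambda>x. if x then G True else G False)" by metis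
    then have "parities k (G True) = prod.swap (parities k (G False))" "G True \<in> Kgrp k" "G False \<in> Kgrp k"
      using g by (simp_all only: Kgrp_wreath admissible_wreath_parities all_bool_eq if_True if_False)
    then show "g \<in> ?R" using eq by blast
  qed
  show "?R \<subseteq> Kgrp k" by (auto simp: Kgrp_wreath admissible_wreath_parities)
qed

text \<open>For each first section a quarter of the second ones is allowed, and the root flip
  doubles the count.\<close>

lemma card_restr_Kgrp_Suc:
  assumes n: "n \<ge> k + 3"
  shows "2 * card (restr (Suc n) ` Kgrp k) = (card (restr n ` Kgrp k))\<^sup>2"
proof -
  let ?C = "restr n ` Kgrp k"
  let ?Q = "{(g, h). g \<in> Kgrp k \<and> h \<in> Kgrp k \<and> parities k h = prod.swap (parities k g)}"
  have "map_prod (restr n) (restr n) ` ?Q = Sigma ?C (\<lambda>p. {q \<in> ?C. parities k q = prod.swap (parities k p)})"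
  proof safe
    fix g h assume "g \<in> Kgrp k" "h \<in> Kgrp k" "parities k (restr n h) = prod.swap (parities k (restr n g))"
    then show "(restr n g, restr n h) \<in> map_prod (restr n) (restr n) ` ?Q"
      using parities_restr [OF n] by (intro image_eqI [of _ _ "(g, h)"]) auto
  qed (auto simp: parities_restr [OF n])
  then have "card (map_prod (restr n) (restr n) ` ?Q) =
      (\<Sum>p\<in>?C. card {q \<in> ?C. parities k q = prod.swap (parities k p)})"
    using finite_restr_Kgrp by simp
  then have "4 * card (map_prod (restr n) (restr n) ` ?Q) =
      (\<Sum>p\<in>?C. 4 * card {q \<in> ?C. parities k q = prod.swap (parities k p)})"
    by (simp only: sum_distrib_left)
  also have "\<dots> = (card ?C)\<^sup>2"
    by (simp only: card_parities_fibre [OF n]) (simp add: power2_eq_square id_apply)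
  finally have four: "4 * card (map_prod (restr n) (restr n) ` ?Q) = (card ?C)\<^sup>2" .
  have "card (restr (Suc n) ` Kgrp k) = 2 * card (map_prod (restr n) (restr n) ` ?Q)"
    by (subst Kgrp_eq_wreath_pairs, rule card_restr_Suc)
  then show ?thesis using four by simp
qed

text \<open>The logarithms satisfy \<open>L (n + 1) = 2 * L n - 1\<close>, so \<open>L n - 1\<close>
  doubles. At level \<open>k + 3\<close> there is no constraint yet, and \<open>L\<close> has the
  value \<open>2 ^ (k + 3) - 1\<close> of the full group.\<close>

lemma log_card_restr_Kgrp:
  "log 2 (real (card (restr (m + (k + 3)) ` Kgrp k))) = 2 ^ (m + (k + 3)) * (1 - 1 / 2 ^ (k + 2)) + 1"
proof (induction m)
  case 0
  have "restr (k + 3) ` Kgrp k = restr (k + 3) ` Aut"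
  proof
    show "restr (k + 3) ` Kgrp k \<subseteq> restr (k + 3) ` Aut" using Kgrp_Aut by blast
    show "restr (k + 3) ` Aut \<subseteq> restr (k + 3) ` Kgrp k"
    proof
      fix p assume "p \<in> restr (k + 3) ` Aut"
      then obtain g where g: "g \<in> Aut" "p = restr (k + 3) g" by blast
      then show "p \<in> restr (k + 3) ` Kgrp k"
        using Hgrp_dense_Aut [OF g(1), of "k + 3" k] Hgrp_Kgrp by auto
    qed
  qed
  then show ?case by (simp add: log_card_restr_Aut right_diff_distrib power_add)
next
  case (Suc m)
  let ?c = "\<lambda>n. real (card (restr n ` Kgrp k))"
  have ne: "Kgrp k \<noteq> {}" using Kgrp_subgroup [of k] by (auto simp: is_subgroup_of_def)
  then have pos: "?c n > 0" for n by (simp add: card_gt_0_iff finite_restr_Kgrp)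
  have "2 * card (restr (Suc (m + (k + 3))) ` Kgrp k) = (card (restr (m + (k + 3)) ` Kgrp k))\<^sup>2"
    by (rule card_restr_Kgrp_Suc) simp
  from arg_cong [OF this, of real]
  have "2 * ?c (Suc (m + (k + 3))) = (?c (m + (k + 3)))\<^sup>2"
    by (simp only: of_nat_mult of_nat_numeral of_nat_power)
  then have "log 2 (2 * ?c (Suc (m + (k + 3)))) = log 2 ((?c (m + (k + 3)))\<^sup>2)" by simp
  then have "1 + log 2 (?c (Suc (m + (k + 3)))) = 2 * log 2 (?c (m + (k + 3)))"
    using pos [of "Suc (m + (k + 3))"] pos [of "m + (k + 3)"]
    by (subst (asm) log_mult) (simp_all add: log_nat_power)
  then have "log 2 (?c (Suc (m + (k + 3)))) = 2 * (2 ^ (m + (k + 3)) * (1 - 1 / 2 ^ (k + 2)) + 1) - 1"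
    unfolding Suc by linarith
  then show ?case unfolding add_Suc power_Suc by (simp only: ring_distribs)
qed

lemma Hdim_Kgrp: "Hdim (Kgrp k) = ereal (1 - 1 / 2 ^ (k + 2))"
proof -
  let ?q = "1 - 1 / 2 ^ (k + 2) :: real"
  let ?f = "\<lambda>n. log 2 (real (card (restr n ` Kgrp k))) / log 2 (real (card (restr n ` Aut)))"
  \<comment> \<open>This is the quotient of logarithms with numerator and denominator divided by
    \<open>2 ^ n\<close>. It converges, so the lower limit is a limit.\<close>
  have "((\<lambda>n. (?q + (1 / 2) ^ n) / (1 - (1 / 2) ^ n)) \<longlongrightarrow> (?q + 0) / (1 - 0)) sequentially"
    by (intro tendsto_intros LIMSEQ_realpow_zero) auto
  moreover have "eventually (\<lambda>n. (?q + (1 / 2) ^ n) / (1 - (1 / 2) ^ n) = ?f n) sequentially"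
  proof (rule eventually_sequentiallyI [of "k + 3"])
    fix n assume "k + 3 \<le> n"
    then obtain m where m: "n = m + (k + 3)" by (metis add.commute le_Suc_ex)
    have "?f n = (2 ^ n * ?q + 1) / (2 ^ n - 1)"
      unfolding log_card_restr_Aut by (simp only: m log_card_restr_Kgrp)
    also have "\<dots> = (2 ^ n * (?q + (1 / 2) ^ n)) / (2 ^ n * (1 - (1 / 2) ^ n))"
      by (simp add: algebra_simps power_one_over)
    also have "\<dots> = (?q + (1 / 2) ^ n) / (1 - (1 / 2) ^ n)" by simp
    finally show "(?q + (1 / 2) ^ n) / (1 - (1 / 2) ^ n) = ?f n" ..
  qed
  ultimately have "?f \<longlonglongrightarrow> ?q" by (auto elim: Lim_transform_eventually)
  then have "(\<lambda>n. ereal (?f n)) \<longlonglongrightarrow> ereal ?q" by simp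
  then show ?thesis unfolding Hdim_def by (intro lim_imp_Liminf) simp_all
qed

lemma finite_gens: "finite (gens k)"
proof -
  have "gens k = (\<lambda>i. act k (R i)) ` {..k} \<union> (\<lambda>j. act k (B j)) ` {..<3}"
    by (auto simp: gens_def)
  then show ?thesis by simp
qed

theorem theorem4:
  fixes k :: nat
  assumes "k \<ge> 1"
  shows "top_fin_gen (tclosure (Hgrp k))
    \<and> finitely_constrained (tclosure (Hgrp k))
    \<and> defined_by_patterns_of_size (tclosure (Hgrp k)) (k + 4)
    \<and> Hdim (tclosure (Hgrp k)) = ereal (1 - 2 / 2 ^ (k + 4 - 1))"
proof -
  note K = tclosure_Hgrp [OF assms]
  have "top_fin_gen (Kgrp k)"
    unfolding top_fin_gen_def using finite_gens gens_Kgrp K [unfolded Hgrp_def] by blast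
  moreover have c: "constrained_by_size (Kgrp k) (k + 4)"
    unfolding constrained_by_size_def using Pgrp_essential Kgrp_eq_G_P by blast
  moreover have "2 / 2 ^ (k + 4 - 1) = (1 / 2 ^ (k + 2) :: real)"
    by (simp add: power_add eval_nat_numeral)
  ultimately show ?thesis
    unfolding K using Kgrp_pattern_size Hdim_Kgrp [of k]
    by (auto simp: finitely_constrained_def defined_by_patterns_of_size_def)
qed

end
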